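(* There are absolute constants $c>0$, $C\ge1$ and $d_0$ such that for all $d\ge d_0$ and $n\ge Cd$, the following hold for randomized row-streaming algorithms whose input is a matrix $A\in\mathbb{R}^{n\times d}$ and which make a constant number $p\ge1$ of passes over the data. (1) For every integer $t\ge2$, any randomized algorithm which for every matrix $A$, with probability at least $2/3$, computes a $\sqrt t$-approximation to all the leverage scores of $A$ with $p$ passes uses space at least $c\,d/(t^2p\log t)$. (2) For every integer $t\ge2$ and every $\lambda\ge0$, any randomized streaming algorithm which for every matrix $A$ with $\lambda\le\frac{\mathrm{sr}(A)}{2d}\sigma_1(A)^2$, with probability at least $2/3$, computes a $\sqrt{t/2}$-approximation to all the $\lambda$-ridge leverage scores of $A$ with $p$ passes uses space at least $c\,d/(pt^2\log t)$. (3) For $2\le k\le d/2$, any randomized streaming algorithm which for every matrix $A$, with probability at least $2/3$, computes any (finite-factor) multiplicative approximation to all the rank-$k$ leverage scores of $A$ using $p$ passes uses space at least $c\,d/p$. (4) For $2\le k\le d/2$, any randomized algorithm which for every matrix $A$, with probability at least $2/3$, computes any (finite-factor) multiplicative approximation to the distances of every row of $A$ from the principal $k$-dimensional subspace with $p$ passes uses space at least $c\,d/p$.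
   Context: For $A\in\mathbb{R}^{n\times d}$ with rows $a_{(i)}$ (as column vectors) and SVD $A=U\Sigma V^T$, $\sigma_1\ge\dots\ge\sigma_d\ge0$, with $v^{(j)}$ the $j$-th column of $V$, define for each row $i$: leverage score $L(i)=\sum_{j:\sigma_j>0}(a_{(i)}^Tv^{(j)})^2/\sigma_j^2$; $\lambda$-ridge leverage score $L_\lambda(i)=\sum_{j:\ \sigma_j>0}(a_{(i)}^Tv^{(j)})^2/(\sigma_j^2+\lambda)$; rank-$k$ leverage score $L^k(i)=\sum_{j\le k,\ \sigma_j>0}(a_{(i)}^Tv^{(j)})^2/\sigma_j^2$; distance from the principal $k$-dimensional subspace (rank-$k$ projection distance) $T^k(i)=\sum_{j=k+1}^d(a_{(i)}^Tv^{(j)})^2$. If the top-$k$ right singular subspace is not unique, the rank-$k$ quantities are taken with respect to some choice of SVD of $A$ (an algorithm is correct if its outputs approximate the quantities for one such choice). $\mathrm{sr}(A)=\|A\|_F^2/\sigma_1(A)^2$ is the stable rank. A $c'$-approximation ($c'\ge1$) to a quantity $x\ge0$ is a number $\tilde x$ with $x/c'\le\tilde x\le c'x$. Row-streaming model: in each pass the rows of $A$ arrive one after the other. Space is the working space in bits (the state kept between arrivals); the algorithm may have free access to a separate random string, and its outputs are not counted towards the working space. *)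

theory Defs
  imports "HOL-Probability.Probability" "Jordan_Normal_Form.Matrix"
begin

unbundle no inner_syntax

(* Thin form of the SVD: U has orthonormal columns, which requires dim_row A \<ge> dim_col A.
   Singular values and right singular vectors are indexed from 0 here. *)
definition thin_svd :: "real mat \<Rightarrow> real mat \<Rightarrow> (nat \<Rightarrow> real) \<Rightarrow> real mat \<Rightarrow> bool" where
  "thin_svd A U \<sigma> V \<longleftrightarrow>
     U \<in> carrier_mat (dim_row A) (dim_col A) \<and>
     V \<in> carrier_mat (dim_col A) (dim_col A) \<and>
     transpose_mat U * U = 1\<^sub>m (dim_col A) \<and>
     transpose_mat V * V = 1\<^sub>m (dim_col A) \<and>
     (\<forall>j<dim_col A. 0 \<le> \<sigma> j) \<and>
     (\<forall>i j. i \<le> j \<longrightarrow> j < dim_col A \<longrightarrow> \<sigma> j \<le> \<sigma> i) \<and>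
     A = U * mat_diag (dim_col A) \<sigma> * transpose_mat V"

definition leverage_score :: "real mat \<Rightarrow> (nat \<Rightarrow> real) \<Rightarrow> real mat \<Rightarrow> nat \<Rightarrow> real" where
  "leverage_score A \<sigma> V i =
     (\<Sum>j | j < dim_col A \<and> \<sigma> j > 0. (Matrix.row A i \<bullet> Matrix.col V j)\<^sup>2 / (\<sigma> j)\<^sup>2)"

definition ridge_leverage_score ::
    "real \<Rightarrow> real mat \<Rightarrow> (nat \<Rightarrow> real) \<Rightarrow> real mat \<Rightarrow> nat \<Rightarrow> real" where
  "ridge_leverage_score lam A \<sigma> V i =
     (\<Sum>j | j < dim_col A \<and> \<sigma> j > 0. (Matrix.row A i \<bullet> Matrix.col V j)\<^sup>2 / ((\<sigma> j)\<^sup>2 + lam))"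

definition rank_leverage_score ::
    "nat \<Rightarrow> real mat \<Rightarrow> (nat \<Rightarrow> real) \<Rightarrow> real mat \<Rightarrow> nat \<Rightarrow> real" where
  "rank_leverage_score k A \<sigma> V i =
     (\<Sum>j | j < dim_col A \<and> j < k \<and> \<sigma> j > 0. (Matrix.row A i \<bullet> Matrix.col V j)\<^sup>2 / (\<sigma> j)\<^sup>2)"

(* The sum of squares itself, without a square root. The singular values play no role; the argument
   is kept so that all four quantities have the same type. *)
definition rank_projection_distance ::
    "nat \<Rightarrow> real mat \<Rightarrow> (nat \<Rightarrow> real) \<Rightarrow> real mat \<Rightarrow> nat \<Rightarrow> real" where
  "rank_projection_distance k A \<sigma> V i =
     (\<Sum>j\<in>{k..<dim_col A}. (Matrix.row A i \<bullet> Matrix.col V j)\<^sup>2)"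

definition frobenius_norm :: "real mat \<Rightarrow> real" where
  "frobenius_norm A = sqrt (\<Sum>i<dim_row A. \<Sum>j<dim_col A. (A $$ (i, j))\<^sup>2)"

definition largest_singular_value :: "real mat \<Rightarrow> real" where
  "largest_singular_value A = (THE s. \<exists>U \<sigma> V. thin_svd A U \<sigma> V \<and> s = \<sigma> 0)"

definition stable_rank :: "real mat \<Rightarrow> real" where
  "stable_rank A = (frobenius_norm A)\<^sup>2 / (largest_singular_value A)\<^sup>2"

definition is_approximation :: "real \<Rightarrow> real \<Rightarrow> real \<Rightarrow> bool" where
  "is_approximation c x y \<longleftrightarrow> x / c \<le> y \<and> y \<le> c * x"

(* A streaming algorithm for a fixed input size. Both functions receive the random string, the pass
   number, the index of the arriving row, the memory contents and the arriving row, in this order.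
   The random string and the position in the stream are read-only and not part of the memory.
   An output (i, y) claims that y approximates the quantity of row i. Outputs are write-only, and
   row i may be reported at any arrival, not only at its own. *)
record streaming_alg =
  update :: "bool stream \<Rightarrow> nat \<Rightarrow> nat \<Rightarrow> bool list \<Rightarrow> real vec \<Rightarrow> bool list"
  emit :: "bool stream \<Rightarrow> nat \<Rightarrow> nat \<Rightarrow> bool list \<Rightarrow> real vec \<Rightarrow> (nat \<times> real) list"

definition coin_tosses :: "bool stream measure" where
  "coin_tosses = stream_space (measure_pmf (bernoulli_pmf (1/2)))"

(* The memory contents after m arrivals, counted over all passes: arrival m (from 0) is that of row
   m mod n in pass m div n, where n is the number of rows. *)
primrec memory :: "streaming_alg \<Rightarrow> bool stream \<Rightarrow> real mat \<Rightarrow> nat \<Rightarrow> bool list" where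
  "memory alg \<omega> A 0 = []"
| "memory alg \<omega> A (Suc m) =
     update alg \<omega> (m div dim_row A) (m mod dim_row A) (memory alg \<omega> A m)
       (Matrix.row A (m mod dim_row A))"

definition outputs ::
    "streaming_alg \<Rightarrow> nat \<Rightarrow> bool stream \<Rightarrow> real mat \<Rightarrow> (nat \<times> real) set" where
  "outputs alg p \<omega> A =
     (\<Union>m<p * dim_row A.
        set (emit alg \<omega> (m div dim_row A) (m mod dim_row A) (memory alg \<omega> A m)
               (Matrix.row A (m mod dim_row A))))"

(* Worst case over the inputs in D and over the random string. *)
definition uses_space_at_least :: "streaming_alg \<Rightarrow> nat \<Rightarrow> real mat set \<Rightarrow> real \<Rightarrow> bool" where
  "uses_space_at_least alg p D s \<longleftrightarrow>
     (\<exists>A\<in>D. \<exists>\<omega>. \<exists>m<p * dim_row A. s \<le> real (length (memory alg \<omega> A m)))"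

(* The singular value decomposition is not unique; an output is accepted if it is right for one of
   them. Every row must be reported, and all reports must be right. *)
definition approximates_all ::
    "real \<Rightarrow> (real mat \<Rightarrow> (nat \<Rightarrow> real) \<Rightarrow> real mat \<Rightarrow> nat \<Rightarrow> real) \<Rightarrow> real mat \<Rightarrow> (nat \<times> real) set \<Rightarrow> bool"
  where
  "approximates_all c Q A Y \<longleftrightarrow>
     (\<exists>U \<sigma> V. thin_svd A U \<sigma> V \<and>
        (\<forall>i<dim_row A. \<exists>y. (i, y) \<in> Y) \<and>
        (\<forall>(i, y)\<in>Y. i < dim_row A \<and> is_approximation c (Q A \<sigma> V i) y))"

definition solves_whp ::
    "streaming_alg \<Rightarrow> nat \<Rightarrow> real mat set \<Rightarrow> (real mat \<Rightarrow> (nat \<times> real) set \<Rightarrow> bool) \<Rightarrow> bool" where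
  "solves_whp alg p D correct \<longleftrightarrow>
     (\<forall>A\<in>D. \<P>(\<omega> in coin_tosses. correct A (outputs alg p \<omega> A)) \<ge> 2/3)"

end

theory Submission
  imports Defs "Jordan_Normal_Form.Determinant"
begin

text \<open>
  All four bounds come from one two-party problem. Alice holds a set \<open>S\<close> of coordinates and an integer
  \<open>r\<close>, Bob an integer vector \<open>y\<close> with entries below \<open>N = 2 ^ m\<close> and an integer \<open>s\<close>; they are promised that
  \<open>(\<Sum>i\<in>S. y i) + r + s\<close> is \<open>0\<close> or \<open>1\<close> and have to tell which. Since the entries of \<open>y\<close> are so large,
  the discrepancy of this problem is exponentially small in \<open>m\<close> by an application of the
  Cauchy-Schwarz inequality. A streaming algorithm with \<open>p\<close> passes and space \<open>b\<close>, run on the rows of Alice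
  followed by the rows of Bob, partitions the inputs into at most \<open>2 powr (4 * p * b)\<close> rectangles
  according to its memory contents at the transitions, so \<open>p * b\<close> is of order at least \<open>m\<close>.

  The sum is the inner product of the real vectors \<open>(1\<^sub>S, r, 1)\<close> and \<open>(y, 1, s)\<close>. For
  (ridge) leverage scores, Alice's rows are a large multiple of a basis of the hyperplane orthogonal
  to her vector: Bob's vector has a tiny score if it lies in that hyperplane and a score of at least
  \<open>1 / 2\<close> otherwise. As the gap is arbitrarily large, the bound does not depend on the approximation
  factor. For the rank-\<open>k\<close> quantities, Alice's rows are a large multiple of her vector, together with
  \<open>k - 1\<close> large multiples of fresh unit vectors: they span the principal \<open>k\<close>-dimensional subspace
  if and only if Bob's vector is orthogonal to Alice's.
\<close>

subsection \<open>Discrepancy of the two-party problem\<close>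

text \<open>The signed weight of the promise problem: pairing values \<open>0\<close> and
  \<open>1\<close> count with opposite signs, so the sum over a rectangle is its bias towards one
  answer.\<close>

definition unit_jump :: "int \<Rightarrow> real" where
  "unit_jump t = of_bool (t = 0) - of_bool (t = 1)"

lemma sum_abs_unit_jump_le:
  assumes "finite F"
  shows "(\<Sum>r\<in>F. \<bar>unit_jump (r + c)\<bar>) \<le> 2"
proof -
  have "(\<Sum>r\<in>F. \<bar>unit_jump (r + c)\<bar>)
      = (\<Sum>r\<in>F. (if r = - c then 1 else 0) + (if r = 1 - c then 1 else 0))"
    by (intro sum.cong) (auto simp: unit_jump_def)
  also have "\<dots> \<le> 2"
    using assms by (simp add: sum.distrib)
  finally show ?thesis .
qed

text \<open>Only \<open>s = - u\<close> and \<open>s = 1 - u\<close> contribute, and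
  \<open>0 \<le> u \<le> R\<close> places both in the range. The result is a second difference in
  \<open>u' - u\<close>, which telescopes later.\<close>

lemma sum_unit_jump_mult:
  assumes "0 \<le> u" "u \<le> R"
  shows "(\<Sum>s\<in>{-R..1}. unit_jump (u + s) * unit_jump (u' + s))
    = unit_jump (u' - u) - unit_jump (u' - u + 1)"
proof -
  have "(\<Sum>s\<in>{-R..1}. unit_jump (u + s) * unit_jump (u' + s))
      = (\<Sum>s\<in>{-R..1}. (if s = - u then unit_jump (u' + s) else 0)
          - (if s = 1 - u then unit_jump (u' + s) else 0))"
    by (intro sum.cong) (auto simp: unit_jump_def)
  also have "\<dots> = unit_jump (u' - u) - unit_jump (u' + (1 - u))"
    using assms by (simp add: sum_subtractf)
  finally show ?thesis by (simp add: algebra_simps)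
qed

lemma sum_second_difference:
  "(\<Sum>j\<in>{0..<int N}. unit_jump (c + j) - unit_jump (c + j + 1)) = unit_jump c - unit_jump (c + N)"
proof -
  have "(\<Sum>j\<in>{0..<int N}. unit_jump (c + j) - unit_jump (c + j + 1))
      = (\<Sum>j<N. unit_jump (c + int j) - unit_jump (c + int (Suc j)))"
    by (rule sum.reindex_bij_witness[where i = int and j = nat]) (auto simp: algebra_simps)
  also have "\<dots> = unit_jump c - unit_jump (c + N)"
    by (subst sum_lessThan_telescope') simp
  finally show ?thesis .
qed

lemma sum_second_difference_reflected:
  "(\<Sum>j\<in>{0..<int N}. unit_jump (c - j) - unit_jump (c - j + 1))
    = unit_jump (c - N + 1) - unit_jump (c + 1)"
proof -
  have "(\<Sum>j\<in>{0..<int N}. unit_jump (c - j) - unit_jump (c - j + 1))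
      = (\<Sum>j\<in>{0..<int N}. unit_jump (c - int N + 1 + j) - unit_jump (c - int N + 1 + j + 1))"
    by (rule sum.reindex_bij_witness[where i = "\<lambda>j. int N - 1 - j" and j = "\<lambda>j. int N - 1 - j"])
      (auto simp: algebra_simps)
  also have "\<dots> = unit_jump (c - N + 1) - unit_jump (c - N + 1 + N)"
    by (rule sum_second_difference)
  finally show ?thesis by simp
qed

text \<open>Cauchy-Schwarz over the columns turns the bias of a rectangle into correlations between
  rows. Squares are nonnegative, so \<open>Y\<close> may be enlarged to \<open>Q\<close>; absolute
  values then allow the inner sum to run over \<open>P\<close>.\<close>

lemma rectangle_sum_squared_le:
  fixes g :: "'a \<Rightarrow> 'b \<Rightarrow> real" and B :: real
  assumes fin: "finite P" "finite Q" and sub: "X \<subseteq> P" "Y \<subseteq> Q"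
    and B: "\<And>a. a \<in> P \<Longrightarrow> (\<Sum>a'\<in>P. \<bar>\<Sum>b\<in>Q. g a b * g a' b\<bar>) \<le> B"
  shows "(\<Sum>a\<in>X. \<Sum>b\<in>Y. g a b)\<^sup>2 \<le> card Q * (card P * B)"
proof (cases "P = {}")
  case True
  then show ?thesis using sub by simp
next
  case False
  have finX: "finite X" and finY: "finite Y" using fin sub finite_subset by auto
  have B0: "0 \<le> B" using False B by (meson all_not_in_conv order_trans sum_nonneg abs_ge_zero)
  have "(\<Sum>a\<in>X. \<Sum>b\<in>Y. g a b)\<^sup>2 = (\<Sum>b\<in>Y. 1 * (\<Sum>a\<in>X. g a b))\<^sup>2"
    by (subst sum.swap) simp
  also have "\<dots> \<le> (\<Sum>b\<in>Y. 1\<^sup>2) * (\<Sum>b\<in>Y. (\<Sum>a\<in>X. g a b)\<^sup>2)"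
    by (rule Cauchy_Schwarz_ineq_sum)
  also have "\<dots> \<le> card Q * (\<Sum>b\<in>Q. (\<Sum>a\<in>X. g a b)\<^sup>2)"
    using fin sub by (intro mult_mono) (auto intro!: sum_mono2 card_mono sum_nonneg)
  also have "(\<Sum>b\<in>Q. (\<Sum>a\<in>X. g a b)\<^sup>2) = (\<Sum>a\<in>X. \<Sum>a'\<in>X. \<Sum>b\<in>Q. g a b * g a' b)"
  proof -
    have "(\<Sum>b\<in>Q. (\<Sum>a\<in>X. g a b)\<^sup>2) = (\<Sum>b\<in>Q. \<Sum>a\<in>X. \<Sum>a'\<in>X. g a b * g a' b)"
      by (simp add: power2_eq_square sum_product)
    also have "\<dots> = (\<Sum>a\<in>X. \<Sum>b\<in>Q. \<Sum>a'\<in>X. g a b * g a' b)" by (rule sum.swap)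
    also have "\<dots> = (\<Sum>a\<in>X. \<Sum>a'\<in>X. \<Sum>b\<in>Q. g a b * g a' b)"
      by (intro sum.cong refl sum.swap)
    finally show ?thesis .
  qed
  also have "\<dots> \<le> (\<Sum>a\<in>X. B)"
  proof (rule sum_mono)
    fix a assume "a \<in> X"
    have "(\<Sum>a'\<in>X. \<Sum>b\<in>Q. g a b * g a' b) \<le> (\<Sum>a'\<in>X. \<bar>\<Sum>b\<in>Q. g a b * g a' b\<bar>)"
      by (intro sum_mono) auto
    also have "\<dots> \<le> (\<Sum>a'\<in>P. \<bar>\<Sum>b\<in>Q. g a b * g a' b\<bar>)"
      using fin sub by (intro sum_mono2) auto
    also have "\<dots> \<le> B" using B \<open>a \<in> X\<close> sub by auto
    finally show "(\<Sum>a'\<in>X. \<Sum>b\<in>Q. g a b * g a' b) \<le> B" .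
  qed
  also have "\<dots> \<le> card P * B"
    using fin sub B0 by (auto intro!: mult_right_mono card_mono)
  finally show ?thesis by (simp add: mult_left_mono)
qed

section \<open>Input sets of the two players and correlations between Alice's inputs\<close>

type_synonym alice_input = "nat set \<times> int"
type_synonym bob_input = "(nat \<Rightarrow> int) \<times> int"

definition pairing :: "alice_input \<Rightarrow> bob_input \<Rightarrow> int" where
  "pairing a b = (\<Sum>i\<in>fst a. fst b i) + snd a + snd b"

text \<open>The offset \<open>r\<close> spreads Alice's inputs over \<open>L\<close> shifts: summed
  over all of them, a shifted jump has total mass at most \<open>2\<close>.\<close>

definition alice_inputs :: "nat \<Rightarrow> nat \<Rightarrow> alice_input set" where
  "alice_inputs m L = Pow {..<m} \<times> {0..<int L}"

text \<open>The range of \<open>s\<close> contains, for every input of Alice and every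
  \<open>y\<close>, the two values that bring the pairing to \<open>0\<close> and to
  \<open>1\<close>.\<close>

definition bob_inputs :: "nat \<Rightarrow> nat \<Rightarrow> nat \<Rightarrow> bob_input set" where
  "bob_inputs m L N = ({..<m} \<rightarrow>\<^sub>E {0..<int N}) \<times> {- int (m * N + L)..1}"

lemma finite_alice_inputs: "finite (alice_inputs m L)"
  by (simp add: alice_inputs_def)

lemma finite_bob_inputs: "finite (bob_inputs m L N)"
  by (simp add: bob_inputs_def finite_PiE)

lemma card_alice_inputs: "card (alice_inputs m L) = 2 ^ m * L"
  by (simp add: alice_inputs_def card_cartesian_product card_Pow)

lemma card_bob_inputs: "card (bob_inputs m L N) = N ^ m * (m * N + L + 2)"
proof -
  have "nat (2 + (int m * int N + int L)) = m * N + L + 2"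
    by (metis (no_types, opaque_lifting) add.commute nat_int of_nat_add of_nat_mult of_nat_numeral)
  then show ?thesis
    by (simp add: bob_inputs_def card_cartesian_product card_PiE)
qed

lemma sum_coordinates_le:
  assumes "S \<subseteq> {..<m}" "y \<in> {..<m} \<rightarrow>\<^sub>E {0..<int N}"
  shows "0 \<le> (\<Sum>i\<in>S. y i)" "(\<Sum>i\<in>S. y i) \<le> int (m * N)"
proof -
  have y: "0 \<le> y i" "y i \<le> int N" if "i < m" for i
    using assms(2) that by (force simp: PiE_iff)+
  show "0 \<le> (\<Sum>i\<in>S. y i)" using assms(1) y by (intro sum_nonneg) auto
  have "(\<Sum>i\<in>S. y i) \<le> of_nat (card S) * int N"
    using assms(1) y by (intro sum_bounded_above) auto
  also have "\<dots> \<le> int m * int N"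
    using card_mono[OF _ assms(1)] by (intro mult_right_mono) auto
  finally show "(\<Sum>i\<in>S. y i) \<le> int (m * N)" by simp
qed

lemma sum_PiE_split:
  fixes f :: "(nat \<Rightarrow> int) \<Rightarrow> real"
  assumes "i < m"
  shows "(\<Sum>y\<in>{..<m} \<rightarrow>\<^sub>E T. f y) = (\<Sum>z\<in>({..<m} - {i}) \<rightarrow>\<^sub>E T. \<Sum>j\<in>T. f (z(i := j)))"
proof -
  have "{..<m} \<rightarrow>\<^sub>E T = (\<lambda>(j, z). z(i := j)) ` (T \<times> (({..<m} - {i}) \<rightarrow>\<^sub>E T))"
    using PiE_insert_eq[of i "{..<m} - {i}" "\<lambda>_. T"] assms by (simp add: insert_absorb)
  moreover have "inj_on (\<lambda>(j, z). z(i := j)) (T \<times> (({..<m} - {i}) \<rightarrow>\<^sub>E T))"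
    using inj_combinator[of i "{..<m} - {i}" "\<lambda>_. T"] by simp
  ultimately have "(\<Sum>y\<in>{..<m} \<rightarrow>\<^sub>E T. f y)
      = (\<Sum>(j, z)\<in>T \<times> (({..<m} - {i}) \<rightarrow>\<^sub>E T). f (z(i := j)))"
    by (simp add: sum.reindex case_prod_unfold)
  also have "\<dots> = (\<Sum>j\<in>T. \<Sum>z\<in>({..<m} - {i}) \<rightarrow>\<^sub>E T. f (z(i := j)))"
    by (simp add: sum.cartesian_product)
  also have "\<dots> = (\<Sum>z\<in>({..<m} - {i}) \<rightarrow>\<^sub>E T. \<Sum>j\<in>T. f (z(i := j)))"
    by (rule sum.swap)
  finally show ?thesis .
qed

lemma correlation_eq:
  assumes "(S, r) \<in> alice_inputs m L"
  shows "(\<Sum>b\<in>bob_inputs m L N. unit_jump (pairing (S, r) b) * unit_jump (pairing (S', r') b))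
    = (\<Sum>y\<in>{..<m} \<rightarrow>\<^sub>E {0..<int N}.
         unit_jump ((\<Sum>i\<in>S'. y i) - (\<Sum>i\<in>S. y i) + r' - r)
         - unit_jump ((\<Sum>i\<in>S'. y i) - (\<Sum>i\<in>S. y i) + r' - r + 1))"
proof -
  have "(\<Sum>b\<in>bob_inputs m L N. unit_jump (pairing (S, r) b) * unit_jump (pairing (S', r') b))
      = (\<Sum>y\<in>{..<m} \<rightarrow>\<^sub>E {0..<int N}. \<Sum>s\<in>{- int (m * N + L)..1}.
          unit_jump ((\<Sum>i\<in>S. y i) + r + s) * unit_jump ((\<Sum>i\<in>S'. y i) + r' + s))"
    by (simp add: bob_inputs_def pairing_def sum.cartesian_product case_prod_unfold)
  also have "\<dots> = (\<Sum>y\<in>{..<m} \<rightarrow>\<^sub>E {0..<int N}.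
         unit_jump ((\<Sum>i\<in>S'. y i) + r' - ((\<Sum>i\<in>S. y i) + r))
         - unit_jump ((\<Sum>i\<in>S'. y i) + r' - ((\<Sum>i\<in>S. y i) + r) + 1))"
  proof (rule sum.cong[OF refl])
    fix y assume y: "y \<in> {..<m} \<rightarrow>\<^sub>E {0..<int N}"
    have "S \<subseteq> {..<m}" "0 \<le> r" "r < int L" using assms by (auto simp: alice_inputs_def)
    then show "(\<Sum>s\<in>{- int (m * N + L)..1}.
          unit_jump ((\<Sum>i\<in>S. y i) + r + s) * unit_jump ((\<Sum>i\<in>S'. y i) + r' + s))
        = unit_jump ((\<Sum>i\<in>S'. y i) + r' - ((\<Sum>i\<in>S. y i) + r))
         - unit_jump ((\<Sum>i\<in>S'. y i) + r' - ((\<Sum>i\<in>S. y i) + r) + 1)"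
      using sum_coordinates_le[OF _ y, of S] by (intro sum_unit_jump_mult) auto
  qed
  finally show ?thesis by (simp add: algebra_simps)
qed

text \<open>For equal subsets the partial sums cancel and every \<open>y\<close> contributes alike;
  only the \<open>r'\<close> next to \<open>r\<close> matter.\<close>

lemma sum_correlation_same_le:
  "(\<Sum>r'\<in>{0..<int L}. \<bar>\<Sum>y\<in>{..<m} \<rightarrow>\<^sub>E {0..<int N}.
      unit_jump (r' - r) - unit_jump (r' - r + 1)\<bar>) \<le> 4 * real N ^ m"
proof -
  have "(\<Sum>r'\<in>{0..<int L}. \<bar>\<Sum>y\<in>{..<m} \<rightarrow>\<^sub>E {0..<int N}.
      unit_jump (r' - r) - unit_jump (r' - r + 1)\<bar>)
      = (\<Sum>r'\<in>{0..<int L}. real N ^ m * \<bar>unit_jump (r' - r) - unit_jump (r' - r + 1)\<bar>)"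
    by (simp add: card_PiE abs_mult)
  also have "\<dots> = real N ^ m * (\<Sum>r'\<in>{0..<int L}. \<bar>unit_jump (r' - r) - unit_jump (r' - r + 1)\<bar>)"
    by (simp add: sum_distrib_left)
  also have "\<dots> \<le> real N ^ m * (\<Sum>r'\<in>{0..<int L}. \<bar>unit_jump (r' + (- r))\<bar> + \<bar>unit_jump (r' + (1 - r))\<bar>)"
    by (intro mult_left_mono sum_mono) (auto simp: algebra_simps abs_triangle_ineq4)
  also have "\<dots> \<le> real N ^ m * (2 + 2)"
    unfolding sum.distrib by (intro mult_left_mono add_mono sum_abs_unit_jump_le) auto
  finally show ?thesis by simp
qed

text \<open>If the two subsets differ in \<open>i\<close>, summing the second difference over \<open>y i\<close> telescopes,
  which gains a factor \<open>N\<close>.\<close>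

lemma sum_correlation_different_le:
  assumes "S \<subseteq> {..<m}" "S' \<subseteq> {..<m}" "S \<noteq> S'"
  shows "(\<Sum>r'\<in>{0..<int L}. \<bar>\<Sum>y\<in>{..<m} \<rightarrow>\<^sub>E {0..<int N}.
      unit_jump ((\<Sum>i\<in>S'. y i) - (\<Sum>i\<in>S. y i) + r' - r)
      - unit_jump ((\<Sum>i\<in>S'. y i) - (\<Sum>i\<in>S. y i) + r' - r + 1)\<bar>) \<le> 4 * real N ^ (m - 1)"
proof -
  obtain i where i: "i \<in> S \<longleftrightarrow> i \<notin> S'" using assms(3) by blast
  have im: "i < m" using i assms by auto
  have fin: "finite S" "finite S'" using assms finite_subset by auto
  \<comment> \<open>\<open>w z\<close> collects the coordinates other than \<open>i\<close>, so that
    \<open>y i\<close> enters as a single signed summand.\<close>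
  define w where "w z = (\<Sum>i\<in>S' - {i}. z i) - (\<Sum>i\<in>S - {i}. z i)" for z :: "nat \<Rightarrow> int"
  define \<phi> where "\<phi> t = unit_jump t - unit_jump (t + 1)" for t
  have rem: "sum (z(i := j)) A = (if i \<in> A then j + sum z (A - {i}) else sum z (A - {i}))"
    if "finite A" for A z and j :: int
  proof -
    have z: "sum (z(i := j)) (A - {i}) = sum z (A - {i})" by (intro sum.cong) auto
    show ?thesis
    proof (cases "i \<in> A")
      case True
      then show ?thesis using that z by (simp add: sum.remove[of A i "z(i := j)"] del: fun_upd_apply) simp
    next
      case False
      then show ?thesis using z by simp
    qed
  qed
  \<comment> \<open>Telescoping over \<open>j\<close> leaves two boundary terms. Their offsets are
    \<open>0\<close> and \<open>N\<close> if \<open>i\<close> lies in \<open>S'\<close>, and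
    \<open>1 - N\<close> and \<open>1\<close> if it lies in \<open>S\<close>, where \<open>j\<close>
    enters with a minus sign.\<close>
  obtain a1 a2 :: int where a: "\<And>c. \<bar>\<Sum>j\<in>{0..<int N}. \<phi> (if i \<in> S' then c + j else c - j)\<bar>
      \<le> \<bar>unit_jump (c + a1)\<bar> + \<bar>unit_jump (c + a2)\<bar>"
  proof (cases "i \<in> S'")
    case True
    show ?thesis
      by (rule that[of 0 "int N"])
        (auto simp: True \<phi>_def sum_second_difference abs_triangle_ineq4)
  next
    case False
    have "\<bar>unit_jump (c - N + 1) - unit_jump (c + 1)\<bar> \<le> \<bar>unit_jump (c + (1 - int N))\<bar> + \<bar>unit_jump (c + 1)\<bar>" for c :: int
      using abs_triangle_ineq4[of "unit_jump (c - N + 1)" "unit_jump (c + 1)"] by (simp add: algebra_simps)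
    then show ?thesis
      by (intro that[of "1 - int N" 1]) (simp add: False \<phi>_def sum_second_difference_reflected)
  qed
  let ?Z = "({..<m} - {i}) \<rightarrow>\<^sub>E {0..<int N}"
  have finZ: "finite ?Z" by (simp add: finite_PiE)
  have cZ: "card ?Z = N ^ (m - 1)" using im by (simp add: card_PiE)
  have shift: "sum (z(i := j)) S' - sum (z(i := j)) S + r' - r
      = (if i \<in> S' then (w z + r' - r) + j else (w z + r' - r) - j)" for z r' j
    using i by (simp add: rem[OF fin(1)] rem[OF fin(2)] w_def del: fun_upd_apply)
  have "(\<Sum>r'\<in>{0..<int L}. \<bar>\<Sum>y\<in>{..<m} \<rightarrow>\<^sub>E {0..<int N}.
      unit_jump ((\<Sum>i\<in>S'. y i) - (\<Sum>i\<in>S. y i) + r' - r)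
      - unit_jump ((\<Sum>i\<in>S'. y i) - (\<Sum>i\<in>S. y i) + r' - r + 1)\<bar>)
     = (\<Sum>r'\<in>{0..<int L}. \<bar>\<Sum>z\<in>?Z. \<Sum>j\<in>{0..<int N}.
          \<phi> (if i \<in> S' then (w z + r' - r) + j else (w z + r' - r) - j)\<bar>)"
    unfolding sum_PiE_split[OF im] \<phi>_def[symmetric] shift ..
  also have "\<dots> \<le> (\<Sum>r'\<in>{0..<int L}. \<Sum>z\<in>?Z. \<bar>unit_jump (w z + r' - r + a1)\<bar> + \<bar>unit_jump (w z + r' - r + a2)\<bar>)"
    by (rule sum_mono, rule order_trans[OF sum_abs], rule sum_mono, rule a)
  also have "\<dots> = (\<Sum>z\<in>?Z. (\<Sum>r'\<in>{0..<int L}. \<bar>unit_jump (r' + (w z - r + a1))\<bar>)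
      + (\<Sum>r'\<in>{0..<int L}. \<bar>unit_jump (r' + (w z - r + a2))\<bar>))"
    by (subst sum.swap) (simp add: sum.distrib algebra_simps)
  also have "\<dots> \<le> (\<Sum>z\<in>?Z. 2 + 2)"
    by (intro sum_mono add_mono sum_abs_unit_jump_le) auto
  finally show ?thesis by (simp add: cZ)
qed

text \<open>The equal subset costs \<open>4 * N ^ m\<close>, each other one
  \<open>4 * N ^ (m - 1)\<close>. As there are \<open>2 ^ m\<close> subsets, the choice
  \<open>N = 2 ^ m\<close> balances the two bounds.\<close>

lemma correlation_sum_le:
  assumes "a \<in> alice_inputs m L" "N = 2 ^ m" "1 \<le> m"
  shows "(\<Sum>a'\<in>alice_inputs m L.
      \<bar>\<Sum>b\<in>bob_inputs m L N. unit_jump (pairing a b) * unit_jump (pairing a' b)\<bar>) \<le> 8 * real N ^ m"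
proof -
  obtain S r where a: "a = (S, r)" by force
  have S: "S \<subseteq> {..<m}" using assms by (auto simp: a alice_inputs_def)
  let ?c = "\<lambda>S' r'. \<bar>\<Sum>b\<in>bob_inputs m L N. unit_jump (pairing (S, r) b) * unit_jump (pairing (S', r') b)\<bar>"
  have "(\<Sum>a'\<in>alice_inputs m L.
      \<bar>\<Sum>b\<in>bob_inputs m L N. unit_jump (pairing a b) * unit_jump (pairing a' b)\<bar>)
      = (\<Sum>S'\<in>Pow {..<m}. \<Sum>r'\<in>{0..<int L}. ?c S' r')"
    by (simp add: a alice_inputs_def sum.cartesian_product case_prod_unfold)
  also have "\<dots> \<le> (\<Sum>S'\<in>Pow {..<m}. (if S' = S then 4 * real N ^ m else 0) + 4 * real N ^ (m - 1))"
  proof (rule sum_mono)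
    fix S' assume S': "S' \<in> Pow {..<m}"
    show "(\<Sum>r'\<in>{0..<int L}. ?c S' r') \<le> (if S' = S then 4 * real N ^ m else 0) + 4 * real N ^ (m - 1)"
    proof (cases "S' = S")
      case True
      have "(\<Sum>r'\<in>{0..<int L}. ?c S r') \<le> 4 * real N ^ m"
        using sum_correlation_same_le[where r = r and L = L and m = m and N = N]
        unfolding correlation_eq[OF assms(1)[unfolded a]] diff_self add_0 .
      then show ?thesis by (simp only: True if_True) (simp add: add_increasing2)
    next
      case False
      show ?thesis unfolding correlation_eq[OF assms(1)[unfolded a]]
        using sum_correlation_different_le[where S = S and m = m and S' = S' and N = N and r = r and L = L] S S' False by auto
    qed
  qed
  also have "\<dots> = 4 * real N ^ m + 2 ^ m * (4 * real N ^ (m - 1))"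
    using S by (simp add: sum.distrib card_Pow)
  also have "\<dots> = 8 * real N ^ m"
    using \<open>1 \<le> m\<close> power_Suc[of "real N" "m - 1"] by (simp add: assms(2) del: power_Suc)
  finally show ?thesis .
qed

text \<open>\<open>2 ^ m * L * N ^ m\<close> is the number of input pairs for each promised value;
  relative to it, every rectangle has bias at most \<open>4 / 2 powr (m / 2)\<close>.\<close>

lemma pairing_discrepancy:
  assumes "1 \<le> m" "N = 2 ^ m" "L = m * N + 2" "X \<subseteq> alice_inputs m L" "Y \<subseteq> bob_inputs m L N"
  shows "(\<Sum>a\<in>X. \<Sum>b\<in>Y. unit_jump (pairing a b))\<^sup>2 \<le> 16 * (2 ^ m * real L * real N ^ m)\<^sup>2 / 2 ^ m"
proof -
  have "(\<Sum>a\<in>X. \<Sum>b\<in>Y. unit_jump (pairing a b))\<^sup>2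
      \<le> card (bob_inputs m L N) * (card (alice_inputs m L) * (8 * real N ^ m))"
    by (rule rectangle_sum_squared_le[OF finite_alice_inputs finite_bob_inputs assms(4,5)])
      (rule correlation_sum_le[OF _ assms(2,1)])
  \<comment> \<open>With \<open>L = m * N + 2\<close>, the number \<open>m * N + L + 2\<close> of
    Bob's offsets is exactly \<open>2 * L\<close>.\<close>
  also have "card (bob_inputs m L N) = N ^ m * (2 * L)"
    unfolding card_bob_inputs assms(3) by simp
  also have "real (N ^ m * (2 * L)) * (card (alice_inputs m L) * (8 * real N ^ m))
      = 16 * (2 ^ m * real L * real N ^ m)\<^sup>2 / 2 ^ m"
    by (simp add: card_alice_inputs power2_eq_square)
  finally show ?thesis .
qed

text \<open>For each input of Alice and each \<open>y\<close>, exactly one \<open>s\<close> in range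
  yields \<open>v\<close>, so both values are equally frequent.\<close>

lemma card_pairing_eq:
  assumes "v = 0 \<or> v = 1"
  shows "(\<Sum>a\<in>alice_inputs m L. \<Sum>b\<in>bob_inputs m L N. of_bool (pairing a b = v)) = 2 ^ m * real L * real N ^ m"
proof -
  have "(\<Sum>b\<in>bob_inputs m L N. of_bool (pairing a b = v)) = real N ^ m" if a: "a \<in> alice_inputs m L" for a
  proof -
    obtain S r where [simp]: "a = (S, r)" by force
    have S: "S \<subseteq> {..<m}" "0 \<le> r" "r < int L" using a by (auto simp: alice_inputs_def)
    have "(\<Sum>b\<in>bob_inputs m L N. of_bool (pairing a b = v))
      = (\<Sum>y\<in>{..<m} \<rightarrow>\<^sub>E {0..<int N}. \<Sum>s\<in>{- int (m * N + L)..1}. of_bool ((\<Sum>i\<in>S. y i) + r + s = v))"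
      by (simp add: bob_inputs_def pairing_def sum.cartesian_product case_prod_unfold)
    also have "\<dots> = (\<Sum>y\<in>{..<m} \<rightarrow>\<^sub>E {0..<int N}. \<Sum>s\<in>{- int (m * N + L)..1}.
        if s = v - (\<Sum>i\<in>S. y i) - r then 1 else (0::real))"
      by (intro sum.cong refl) auto
    also have "\<dots> = (\<Sum>y\<in>{..<m} \<rightarrow>\<^sub>E {0..<int N}. (1::real))"
    proof (rule sum.cong[OF refl])
      fix y assume "y \<in> {..<m} \<rightarrow>\<^sub>E {0..<int N}"
      from sum_coordinates_le[OF S(1) this] S assms
      have "v - (\<Sum>i\<in>S. y i) - r \<in> {- int (m * N + L)..1}" by auto
      then show "(\<Sum>s\<in>{- int (m * N + L)..1}. if s = v - (\<Sum>i\<in>S. y i) - r then 1 else (0::real)) = 1"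
        by simp
    qed
    finally show ?thesis by (simp add: card_PiE)
  qed
  then show ?thesis by (simp add: card_alice_inputs)
qed

subsection \<open>Streaming algorithms and rectangles\<close>

text \<open>Cut and paste: \<open>A3\<close> has the first \<open>k\<close> rows, Alice's block,
  from \<open>A1\<close> and Bob's block from \<open>A2\<close>. On entry to a block both runs share
  their memory, so the run on \<open>A3\<close> follows \<open>A1\<close> in the first block and
  \<open>A2\<close> in the second. At the transitions both claims hold, which carries the induction
  across.\<close>

lemma memory_spliced:
  fixes A1 A2 A3 :: "real mat"
  assumes dims: "dim_row A1 = n" "dim_row A2 = n" "dim_row A3 = n" and k: "0 < k" "k < n"
    and first: "\<And>i. i < k \<Longrightarrow> row A3 i = row A1 i"
    and last: "\<And>i. k \<le> i \<Longrightarrow> i < n \<Longrightarrow> row A3 i = row A2 i"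
    and agree: "\<And>m. m < p * n \<Longrightarrow> m mod n = 0 \<or> m mod n = k \<Longrightarrow>
      memory alg \<omega> A1 m = memory alg \<omega> A2 m"
    and "m < p * n"
  shows "(m mod n \<le> k \<longrightarrow> memory alg \<omega> A3 m = memory alg \<omega> A1 m) \<and>
    (m mod n = 0 \<or> k \<le> m mod n \<longrightarrow> memory alg \<omega> A3 m = memory alg \<omega> A2 m)"
  using \<open>m < p * n\<close>
proof (induction m)
  case 0
  then show ?case by simp
next
  case (Suc m)
  have IH: "m mod n \<le> k \<Longrightarrow> memory alg \<omega> A3 m = memory alg \<omega> A1 m"
    "k \<le> m mod n \<Longrightarrow> memory alg \<omega> A3 m = memory alg \<omega> A2 m"
    using Suc by auto
  note ag = agree[OF Suc.prems]
  show ?case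
  proof (cases "m mod n < k")
    case True
    then have mod: "Suc m mod n = Suc (m mod n)" using k by (auto simp: mod_Suc)
    have "memory alg \<omega> A3 (Suc m) = memory alg \<omega> A1 (Suc m)"
      using IH(1) True first by (simp add: dims)
    moreover have "k \<le> Suc (m mod n) \<Longrightarrow> memory alg \<omega> A3 (Suc m) = memory alg \<omega> A2 (Suc m)"
      using calculation ag True mod by auto
    ultimately show ?thesis unfolding mod using True by blast
  next
    case False
    have "m mod n < n" using k by simp
    then have eq: "memory alg \<omega> A3 (Suc m) = memory alg \<omega> A2 (Suc m)"
      using IH(2) False last by (simp add: dims)
    moreover have "Suc m mod n \<le> k \<Longrightarrow> Suc m mod n = 0"
      using False by (auto simp: mod_Suc split: if_splits)
    ultimately show ?thesis using ag by metis
  qed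
qed

text \<open>Outputs are not stored, so the memory at the transitions does not determine them. But
  each report on the spliced input is made in a situation that also occurs in one of the two runs,
  so the absence of a kind of report is inherited.\<close>

lemma outputs_spliced:
  fixes A1 A2 A3 :: "real mat"
  assumes dims: "dim_row A1 = n" "dim_row A2 = n" "dim_row A3 = n" and k: "0 < k" "k < n"
    and first: "\<And>i. i < k \<Longrightarrow> row A3 i = row A1 i"
    and last: "\<And>i. k \<le> i \<Longrightarrow> i < n \<Longrightarrow> row A3 i = row A2 i"
    and agree: "\<And>m. m < p * n \<Longrightarrow> m mod n = 0 \<or> m mod n = k \<Longrightarrow>
      memory alg \<omega> A1 m = memory alg \<omega> A2 m"
  shows "outputs alg p \<omega> A3 \<subseteq> outputs alg p \<omega> A1 \<union> outputs alg p \<omega> A2"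
proof
  fix z assume "z \<in> outputs alg p \<omega> A3"
  then obtain m where m: "m < p * n"
    and z: "z \<in> set (emit alg \<omega> (m div n) (m mod n) (memory alg \<omega> A3 m) (row A3 (m mod n)))"
    by (auto simp: outputs_def dims)
  have "m mod n < n" using k by simp
  note sp = memory_spliced[OF assms m]
  show "z \<in> outputs alg p \<omega> A1 \<union> outputs alg p \<omega> A2"
  proof (cases "m mod n < k")
    case True
    with z sp first have "z \<in> set (emit alg \<omega> (m div n) (m mod n) (memory alg \<omega> A1 m) (row A1 (m mod n)))"
      by simp
    with m show ?thesis by (auto simp: outputs_def dims)
  next
    case False
    with z sp last[of "m mod n"] \<open>m mod n < n\<close>
    have "z \<in> set (emit alg \<omega> (m div n) (m mod n) (memory alg \<omega> A2 m) (row A2 (m mod n)))"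
      by simp
    with m show ?thesis by (auto simp: outputs_def dims)
  qed
qed

text \<open>The exponent \<open>2 * s\<close> instead of \<open>s + 1\<close> keeps the bound free of an additive term, which
  would be multiplied by the number of passes.\<close>

lemma card_short_lists:
  fixes s :: real
  assumes "0 < s"
  shows "finite {xs :: bool list. real (length xs) < s}"
    and "real (card {xs :: bool list. real (length xs) < s}) \<le> 2 powr (2 * s)"
proof -
  define l where "l = nat (\<lceil>s\<rceil> - 1)"
  have l: "real j < s \<longleftrightarrow> j \<le> l" for j :: nat
  proof -
    have "real j < s \<longleftrightarrow> int j < \<lceil>s\<rceil>" by (simp add: less_ceiling_iff)
    moreover have "1 \<le> \<lceil>s\<rceil>" using assms by simp
    ultimately show ?thesis unfolding l_def by linarith
  qed
  have eq: "{xs :: bool list. real (length xs) < s} = {xs. set xs \<subseteq> UNIV \<and> length xs \<le> l}"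
    by (auto simp: l)
  show "finite {xs :: bool list. real (length xs) < s}"
    unfolding eq by (rule finite_lists_length_le) simp
  have "card {xs :: bool list. real (length xs) < s} = (\<Sum>i\<le>l. 2 ^ i)"
    unfolding eq by (subst card_lists_length_le) simp_all
  also have "real \<dots> \<le> 2 powr (2 * s)"
  proof (cases "l = 0")
    case True
    then show ?thesis using assms by (simp add: ge_one_powr_ge_zero)
  next
    case False
    \<comment> \<open>Here \<open>1 \<le> l < s\<close>, so
      \<open>Suc l \<le> 2 * l \<le> 2 * s\<close>.\<close>
    have "real (\<Sum>i\<le>l. 2 ^ i) \<le> real (2 ^ Suc l)"
      unfolding of_nat_le_iff by (induction l) auto
    also have "\<dots> = 2 powr real (Suc l)" by (subst powr_realpow) simp_all
    also have "\<dots> \<le> 2 powr (2 * s)"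
      using False l[of l] by (intro powr_mono) auto
    finally show ?thesis .
  qed
  finally show "real (card {xs :: bool list. real (length xs) < s}) \<le> 2 powr (2 * s)" .
qed

section \<open>From streaming algorithms to discrepancy\<close>

lemma (in prob_space) exists_ge_expectation:
  fixes f :: "'a \<Rightarrow> real"
  assumes "integrable M f" "c \<le> expectation f"
  shows "\<exists>x\<in>space M. c \<le> f x"
proof (rule ccontr)
  assume "\<not> ?thesis"
  then have "AE x in M. f x < c" by (intro AE_I2) auto
  from expectation_less[OF assms(1) this] assms(2) show False by simp
qed

interpretation coin: prob_space coin_tosses
  unfolding coin_tosses_def
  by (rule prob_space.prob_space_stream_space) (rule prob_space_measure_pmf)

text \<open>A random string at least as good as the average is fixed. The inputs on which it makes
  no report satisfying \<open>F\<close>, the signal for \<open>v = 1\<close>, split into rectangles,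
  one for each record of the memory at the \<open>2 * p\<close> transitions. Success on two thirds
  of the total mass \<open>2 * T\<close> gives these inputs bias at least \<open>T / 3\<close>,
  while each rectangle contributes at most \<open>\<delta>\<close>.\<close>

lemma streaming_discrepancy_bound:
  fixes M :: "'a \<Rightarrow> 'b \<Rightarrow> real mat" and v :: "'a \<Rightarrow> 'b \<Rightarrow> int" and F :: "nat \<times> real \<Rightarrow> bool"
    and \<delta> T s :: real
  assumes fin: "finite P" "finite Q" and k: "0 < k" "k < n"
    and D: "\<And>a b. a \<in> P \<Longrightarrow> b \<in> Q \<Longrightarrow> M a b \<in> D" "D \<subseteq> carrier_mat n d"
    and alice: "\<And>a b b' i. a \<in> P \<Longrightarrow> b \<in> Q \<Longrightarrow> b' \<in> Q \<Longrightarrow> i < k \<Longrightarrow> row (M a b) i = row (M a b') i"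
    and bob: "\<And>a a' b i. a \<in> P \<Longrightarrow> a' \<in> P \<Longrightarrow> b \<in> Q \<Longrightarrow> k \<le> i \<Longrightarrow> i < n \<Longrightarrow> row (M a b) i = row (M a' b) i"
    and solves: "solves_whp alg p D correct"
    and c0: "\<And>a b Y. a \<in> P \<Longrightarrow> b \<in> Q \<Longrightarrow> v a b = 0 \<Longrightarrow> correct (M a b) Y \<Longrightarrow> \<forall>z\<in>Y. \<not> F z"
    and c1: "\<And>a b Y. a \<in> P \<Longrightarrow> b \<in> Q \<Longrightarrow> v a b = 1 \<Longrightarrow> correct (M a b) Y \<Longrightarrow> \<exists>z\<in>Y. F z"
    and mass: "(\<Sum>a\<in>P. \<Sum>b\<in>Q. of_bool (v a b = 0)) = T" "(\<Sum>a\<in>P. \<Sum>b\<in>Q. of_bool (v a b = 1)) = T"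
    and disc: "\<And>X Y. X \<subseteq> P \<Longrightarrow> Y \<subseteq> Q \<Longrightarrow> (\<Sum>a\<in>X. \<Sum>b\<in>Y. unit_jump (v a b)) \<le> \<delta>"
    and space: "\<not> uses_space_at_least alg p D s" and s: "0 < s" and \<delta>: "0 \<le> \<delta>"
  shows "T / 3 \<le> 2 powr (4 * real p * s) * \<delta>"
proof -
  have dim: "dim_row (M a b) = n" if "a \<in> P" "b \<in> Q" for a b
    using D(1)[OF that] D(2) by auto
  define w :: "'a \<Rightarrow> 'b \<Rightarrow> real" where "w a b = of_bool (v a b = 0) + of_bool (v a b = 1)" for a b
  define E where "E a b = {\<omega> \<in> space coin_tosses. correct (M a b) (outputs alg p \<omega> (M a b))}" for a b
  have prob: "2 / 3 \<le> measure coin_tosses (E a b)" if "a \<in> P" "b \<in> Q" for a b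
    using solves D(1)[OF that] unfolding solves_whp_def E_def by blast
  \<comment> \<open>\<open>correct\<close> is arbitrary, so measurability is inferred: a set that is
    not measurable has \<open>measure\<close> equal to \<open>0\<close>, against the bound
    \<open>2 / 3\<close>.\<close>
  have sets: "E a b \<in> sets coin_tosses" if "a \<in> P" "b \<in> Q" for a b
    using prob[OF that] measure_notin_sets[of "E a b" coin_tosses] by (cases "E a b \<in> sets coin_tosses") auto
  define f where "f \<omega> = (\<Sum>a\<in>P. \<Sum>b\<in>Q. w a b * indicator (E a b) \<omega>)" for \<omega>
  have int: "integrable coin_tosses (\<lambda>\<omega>. w a b * indicator (E a b) \<omega>)" if "a \<in> P" "b \<in> Q" for a b
    using sets[OF that] by (intro integrable_mult_right) (auto simp: coin.emeasure_eq_measure)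
  have "4 * T / 3 = (\<Sum>a\<in>P. \<Sum>b\<in>Q. w a b * (2 / 3))"
    unfolding sum_distrib_right[symmetric] by (simp add: w_def sum.distrib mass)
  also have "\<dots> \<le> (\<Sum>a\<in>P. \<Sum>b\<in>Q. w a b * measure coin_tosses (E a b))"
    by (intro sum_mono mult_left_mono prob) (auto simp: w_def)
  also have "\<dots> = coin.expectation f"
    unfolding f_def using int sets
    by (simp add: Bochner_Integration.integral_sum)
  finally have "4 * T / 3 \<le> coin.expectation f" .
  moreover have "integrable coin_tosses f"
    unfolding f_def using int by (intro Bochner_Integration.integrable_sum) auto
  ultimately obtain \<omega> where \<omega>: "\<omega> \<in> space coin_tosses" "4 * T / 3 \<le> f \<omega>"
    using coin.exists_ge_expectation by blast
  define mem where "mem a b = memory alg \<omega> (M a b)" for a b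
  define silent where "silent a b \<longleftrightarrow> (\<forall>z\<in>outputs alg p \<omega> (M a b). \<not> F z)" for a b
  define N where "N = {(a, b) \<in> P \<times> Q. silent a b}"
  have finN: "finite N" unfolding N_def using fin by (auto intro: finite_subset[of _ "P \<times> Q"])
  have "T / 3 \<le> f \<omega> - (\<Sum>a\<in>P. \<Sum>b\<in>Q. of_bool (v a b = 1))"
    using \<omega>(2) mass by simp
  also have "\<dots> = (\<Sum>a\<in>P. \<Sum>b\<in>Q. w a b * indicator (E a b) \<omega> - of_bool (v a b = 1))"
    by (simp add: f_def sum_subtractf)
  also have "\<dots> \<le> (\<Sum>a\<in>P. \<Sum>b\<in>Q. of_bool (silent a b) * unit_jump (v a b))"
  proof (intro sum_mono)
    fix a b assume ab: "a \<in> P" "b \<in> Q"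
    \<comment> \<open>If \<open>v = 0\<close>, a correct run is silent; if \<open>v = 1\<close>, a
      silent run is incorrect and loses its unit of mass. Other values have weight
      \<open>0\<close>.\<close>
    show "w a b * indicator (E a b) \<omega> - of_bool (v a b = 1) \<le> of_bool (silent a b) * unit_jump (v a b)"
      using c0[OF ab, of "outputs alg p \<omega> (M a b)"] c1[OF ab, of "outputs alg p \<omega> (M a b)"] \<omega>(1)
      by (auto simp: w_def E_def silent_def unit_jump_def indicator_def)
  qed
  also have "\<dots> = (\<Sum>(a, b)\<in>P \<times> Q. if silent a b then unit_jump (v a b) else 0)"
    by (subst sum.cartesian_product[symmetric]) (intro sum.cong refl, auto)
  also have "\<dots> = (\<Sum>(a, b)\<in>N. unit_jump (v a b))"
    unfolding N_def using fin by (intro sum.mono_neutral_cong_right) (auto split: if_splits)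
  finally have lower: "T / 3 \<le> (\<Sum>(a, b)\<in>N. unit_jump (v a b))" .

  \<comment> \<open>The record of the memory at the transitions: even \<open>j\<close> stands for
    the start of pass \<open>j div 2\<close>, odd \<open>j\<close> for the arrival of Bob's first
    row in that pass.\<close>
  define \<tau> where "\<tau> = (\<lambda>(a, b). map (\<lambda>j. mem a b (j div 2 * n + j mod 2 * k)) [0..<2 * p])"
  define W where "W = {xs :: bool list. real (length xs) < s}"
  define \<Theta> where "\<Theta> = {t. set t \<subseteq> W \<and> length t = 2 * p}"
  have bd: "j div 2 * n + j mod 2 * k < p * n" if "j < 2 * p" for j
  proof -
    have "j mod 2 * k < n"
      using k by (cases "even j") (auto simp: odd_iff_mod_2_eq_one)
    moreover have "Suc (j div 2) * n \<le> p * n" using that by (intro mult_right_mono) auto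
    ultimately show ?thesis by simp
  qed
  have agree: "mem a b m = mem a' b' m"
    if "\<tau> (a, b) = \<tau> (a', b')" "m < p * n" "m mod n = 0 \<or> m mod n = k" for a b a' b' m
  proof -
    have "m div n < p" using that(2) k by (simp add: less_mult_imp_div_less)
    define j where "j = 2 * (m div n) + (if m mod n = 0 then 0 else 1)"
    have j: "j < 2 * p" "m = j div 2 * n + j mod 2 * k"
      using \<open>m div n < p\<close> that(3) div_mult_mod_eq[of m n] by (auto simp: j_def)
    have "\<tau> (a, b) ! j = \<tau> (a', b') ! j" using that(1) by simp
    with j show ?thesis by (simp add: \<tau>_def)
  qed
  have short: "\<tau> ` N \<subseteq> \<Theta>"
  proof (clarsimp simp: N_def \<Theta>_def \<tau>_def mem_def W_def)
    fix a b j assume "a \<in> P" "b \<in> Q" "j < 2 * p"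
    then show "real (length (memory alg \<omega> (M a b) (j div 2 * n + j mod 2 * k))) < s"
      using space D(1)[of a b] bd[of j] dim[of a b] unfolding uses_space_at_least_def
      by (metis linorder_not_le)
  qed
  have fin\<Theta>: "finite \<Theta>" unfolding \<Theta>_def W_def by (intro finite_lists_length_eq card_short_lists s)
  have rect: "(\<Sum>(a, b)\<in>{x \<in> N. \<tau> x = t}. unit_jump (v a b)) \<le> \<delta>" for t
  proof -
    define R where "R = {x \<in> N. \<tau> x = t}"
    \<comment> \<open>Combining Alice's input from one member with Bob's from another keeps the
      record and the silence, so \<open>R\<close> is a rectangle.\<close>
    have cross: "(a, b') \<in> R" if ab: "(a, b) \<in> R" and ab': "(a', b') \<in> R" for a b a' b'
    proof -
      have in_sets: "a \<in> P" "b \<in> Q" "a' \<in> P" "b' \<in> Q" using ab ab' by (auto simp: R_def N_def)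
      have ag: "memory alg \<omega> (M a b) m = memory alg \<omega> (M a' b') m"
        if "m < p * n" "m mod n = 0 \<or> m mod n = k" for m
        using agree[OF _ that] ab ab' by (auto simp: R_def mem_def)
      note splice = dim[OF in_sets(1,2)] dim[OF in_sets(3,4)] dim[OF in_sets(1,4)] k
        alice[OF in_sets(1,4,2)] bob[OF in_sets(1,3,4)] ag
      have "outputs alg p \<omega> (M a b') \<subseteq> outputs alg p \<omega> (M a b) \<union> outputs alg p \<omega> (M a' b')"
        by (rule outputs_spliced[OF splice])
      then have "silent a b'" using ab ab' by (auto simp: R_def N_def silent_def)
      moreover have "mem a b' (j div 2 * n + j mod 2 * k) = mem a b (j div 2 * n + j mod 2 * k)"
        if "j < 2 * p" for j
      proof -
        have "(j div 2 * n + j mod 2 * k) mod n \<le> k"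
          using k by (cases "even j") (auto simp: odd_iff_mod_2_eq_one)
        then show ?thesis
          using memory_spliced[OF splice bd[OF that]] by (simp add: mem_def)
      qed
      then have "\<tau> (a, b') = \<tau> (a, b)" by (simp add: \<tau>_def)
      ultimately show ?thesis using ab in_sets by (auto simp: R_def N_def)
    qed
    have R: "R = fst ` R \<times> snd ` R"
      using cross by (force simp: image_iff)
    have sub: "fst ` R \<subseteq> P" "snd ` R \<subseteq> Q" by (auto simp: R_def N_def)
    have "(\<Sum>(a, b)\<in>R. unit_jump (v a b)) = (\<Sum>a\<in>fst ` R. \<Sum>b\<in>snd ` R. unit_jump (v a b))"
      by (subst R) (rule sum.cartesian_product[symmetric])
    also have "\<dots> \<le> \<delta>" by (rule disc[OF sub])
    finally show ?thesis by (simp add: R_def)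
  qed
  have "(\<Sum>(a, b)\<in>N. unit_jump (v a b)) = (\<Sum>t\<in>\<Theta>. \<Sum>(a, b)\<in>{x \<in> N. \<tau> x = t}. unit_jump (v a b))"
    by (rule sum.group[symmetric]) (use finN fin\<Theta> short in auto)
  also have "\<dots> \<le> (\<Sum>t\<in>\<Theta>. \<delta>)" by (intro sum_mono rect)
  also have "\<dots> = real (card W) ^ (2 * p) * \<delta>"
    using card_short_lists(1)[OF s] by (simp add: \<Theta>_def W_def card_lists_length_eq)
  also have "\<dots> \<le> (2 powr (2 * s)) ^ (2 * p) * \<delta>"
    using card_short_lists(2)[OF s] \<delta> by (intro mult_right_mono power_mono) (auto simp: W_def)
  also have "(2 powr (2 * s)) ^ (2 * p) = 2 powr (4 * real p * s)"
    by (simp add: powr_powr mult_ac flip: powr_realpow)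
  finally show ?thesis using lower by simp
qed

subsection \<open>Singular value decompositions\<close>

definition dot :: "nat \<Rightarrow> (nat \<Rightarrow> real) \<Rightarrow> (nat \<Rightarrow> real) \<Rightarrow> real" where
  "dot d x y = (\<Sum>l<d. x l * y l)"

lemma dot_commute: "dot d x y = dot d y x"
  by (simp add: dot_def mult.commute)

lemma dot_sum_left: "dot d (\<lambda>l. \<Sum>j\<in>J. c j * x j l) y = (\<Sum>j\<in>J. c j * dot d (x j) y)"
  by (simp add: dot_def sum_distrib_right sum_distrib_left mult.assoc)
    (rule sum.swap)

lemma dot_cong: "(\<And>l. l < d \<Longrightarrow> x l = x' l) \<Longrightarrow> (\<And>l. l < d \<Longrightarrow> y l = y' l) \<Longrightarrow> dot d x y = dot d x' y'"
  by (simp add: dot_def)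

lemma dot_self_nonneg: "0 \<le> dot d x x"
  by (simp add: dot_def sum_nonneg)

definition orthonormal :: "nat \<Rightarrow> nat set \<Rightarrow> (nat \<Rightarrow> nat \<Rightarrow> real) \<Rightarrow> bool" where
  "orthonormal d J w \<longleftrightarrow> (\<forall>i\<in>J. \<forall>j\<in>J. dot d (w i) (w j) = of_bool (i = j))"

text \<open>\<open>s\<close> is the orthogonal projection of \<open>x\<close> onto the span of the
  family; the squared norm of \<open>x - s\<close> is the difference of the two sides.\<close>

lemma bessel:
  assumes "finite J" "orthonormal d J w"
  shows "(\<Sum>j\<in>J. (dot d x (w j))\<^sup>2) \<le> dot d x x"
proof -
  define s where "s l = (\<Sum>j\<in>J. dot d x (w j) * w j l)" for l
  define b where "b = (\<Sum>j\<in>J. (dot d x (w j))\<^sup>2)"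
  have s_dot: "dot d s y = (\<Sum>j\<in>J. dot d x (w j) * dot d (w j) y)" for y
    unfolding s_def by (rule dot_sum_left)
  have xs: "dot d x s = b" unfolding dot_commute[of d x s] s_dot
    by (simp add: b_def power2_eq_square dot_commute)
  have sw: "dot d s (w j) = dot d x (w j)" if "j \<in> J" for j
  proof -
    have "dot d s (w j) = (\<Sum>i\<in>J. if i = j then dot d x (w i) else 0)"
      unfolding s_dot using assms(2) that by (intro sum.cong) (auto simp: orthonormal_def)
    then show ?thesis using assms(1) that by simp
  qed
  have ss: "dot d s s = b"
    using sw by (subst s_dot) (simp add: b_def power2_eq_square dot_commute[of d "w j" s for j])
  have "0 \<le> dot d (\<lambda>l. x l - s l) (\<lambda>l. x l - s l)" by (rule dot_self_nonneg)
  also have "\<dots> = dot d x x - 2 * dot d x s + dot d s s"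
    by (simp add: dot_def algebra_simps sum.distrib sum_subtractf sum_distrib_left)
  finally show ?thesis by (simp add: xs ss b_def)
qed

text \<open>Coordinate form of the thin decomposition: \<open>a i\<close> is a row of the matrix,
  \<open>u j\<close> and \<open>v j\<close> are columns of \<open>U\<close> and \<open>V\<close>.
  The factorization appears as \<open>row_dot_v\<close>, the entries of \<open>A * V\<close>;
  \<open>v_complete\<close> expresses orthonormality of the rows of \<open>V\<close>.\<close>

locale svd =
  fixes n d :: nat and a u v :: "nat \<Rightarrow> nat \<Rightarrow> real" and \<sigma> :: "nat \<Rightarrow> real"
  assumes v_orthonormal: "orthonormal d {..<d} v"
    and v_complete: "i < d \<Longrightarrow> j < d \<Longrightarrow> (\<Sum>l<d. v l i * v l j) = of_bool (i = j)"
    and u_orthonormal: "orthonormal n {..<d} u"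
    and \<sigma>_nonneg: "j < d \<Longrightarrow> 0 \<le> \<sigma> j"
    and \<sigma>_antimono: "i \<le> j \<Longrightarrow> j < d \<Longrightarrow> \<sigma> j \<le> \<sigma> i"
    and row_dot_v: "i < n \<Longrightarrow> j < d \<Longrightarrow> dot d (a i) (v j) = \<sigma> j * u j i"
begin

lemma parseval: "dot d x y = (\<Sum>j<d. dot d x (v j) * dot d y (v j))"
proof -
  have "(\<Sum>j<d. dot d x (v j) * dot d y (v j)) = (\<Sum>j<d. \<Sum>l<d. \<Sum>k<d. x l * y k * (v j l * v j k))"
    by (simp add: dot_def sum_product algebra_simps)
  also have "\<dots> = (\<Sum>l<d. \<Sum>j<d. \<Sum>k<d. x l * y k * (v j l * v j k))"
    by (rule sum.swap)
  also have "\<dots> = (\<Sum>l<d. \<Sum>k<d. \<Sum>j<d. x l * y k * (v j l * v j k))"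
    by (intro sum.cong refl sum.swap)
  also have "\<dots> = (\<Sum>l<d. \<Sum>k<d. if k = l then x l * y k else 0)"
    by (intro sum.cong refl) (simp add: v_complete flip: sum_distrib_left)
  also have "\<dots> = dot d x y"
    by (simp add: dot_def)
  finally show ?thesis ..
qed

lemma row_dot: "i < n \<Longrightarrow> dot d (a i) z = (\<Sum>j<d. \<sigma> j * dot d z (v j) * u j i)"
  by (subst parseval) (simp add: row_dot_v algebra_simps)

text \<open>The Gram form of the matrix is diagonal in the basis \<open>v\<close> because the
  \<open>u j\<close> are orthonormal; \<open>gram_v\<close> below is then the eigenvector
  equation.\<close>

lemma gram: "(\<Sum>i<n. dot d (a i) x * dot d (a i) y) = (\<Sum>j<d. (\<sigma> j)\<^sup>2 * (dot d x (v j) * dot d y (v j)))"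
proof -
  let ?x = "\<lambda>j. \<sigma> j * dot d x (v j)" and ?y = "\<lambda>j. \<sigma> j * dot d y (v j)"
  have "(\<Sum>i<n. dot d (a i) x * dot d (a i) y) = (\<Sum>i<n. \<Sum>j<d. \<Sum>k<d. ?x j * ?y k * (u j i * u k i))"
    by (simp add: row_dot sum_product algebra_simps)
  also have "\<dots> = (\<Sum>j<d. \<Sum>i<n. \<Sum>k<d. ?x j * ?y k * (u j i * u k i))"
    by (rule sum.swap)
  also have "\<dots> = (\<Sum>j<d. \<Sum>k<d. \<Sum>i<n. ?x j * ?y k * (u j i * u k i))"
    by (intro sum.cong refl sum.swap)
  also have "\<dots> = (\<Sum>j<d. \<Sum>k<d. if k = j then ?x j * ?y k else 0)"
    using u_orthonormal
    by (intro sum.cong refl) (auto simp: orthonormal_def dot_def simp flip: sum_distrib_left)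
  also have "\<dots> = (\<Sum>j<d. (\<sigma> j)\<^sup>2 * (dot d x (v j) * dot d y (v j)))"
    by (simp add: power2_eq_square algebra_simps)
  finally show ?thesis .
qed

lemma gram_v:
  assumes "j < d"
  shows "(\<Sum>i<n. dot d (a i) x * dot d (a i) (v j)) = (\<sigma> j)\<^sup>2 * dot d x (v j)"
proof -
  have "(\<Sum>i<n. dot d (a i) x * dot d (a i) (v j))
      = (\<Sum>k<d. if k = j then (\<sigma> k)\<^sup>2 * dot d x (v k) else 0)"
    unfolding gram using v_orthonormal assms
    by (intro sum.cong refl) (auto simp: orthonormal_def)
  then show ?thesis using assms by simp
qed

text \<open>Cauchy-Schwarz with weights \<open>sqrt ((\<sigma> j)\<^sup>2 + lam)\<close>: every test
  vector \<open>z\<close> gives a lower bound on the score. Directions with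
  \<open>\<sigma> j = 0\<close> drop out, as all rows are orthogonal to them.\<close>

lemma ridge_lower:
  assumes "i < n" "0 \<le> lam"
  shows "(dot d (a i) z)\<^sup>2 \<le> (\<Sum>j | j < d \<and> \<sigma> j > 0. (dot d (a i) (v j))\<^sup>2 / ((\<sigma> j)\<^sup>2 + lam))
    * ((\<Sum>l<n. (dot d (a l) z)\<^sup>2) + lam * dot d z z)"
proof -
  let ?J = "{j. j < d \<and> \<sigma> j > 0}"
  have sub: "?J \<subseteq> {..<d}" by auto
  define s where "s j = sqrt ((\<sigma> j)\<^sup>2 + lam)" for j
  have s: "s j > 0" "(s j)\<^sup>2 = (\<sigma> j)\<^sup>2 + lam" if "j \<in> ?J" for j
    using that assms(2) by (auto simp: s_def add_pos_nonneg)
  have "dot d (a i) z = (\<Sum>j\<in>?J. dot d (a i) (v j) * dot d z (v j))"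
    unfolding parseval[of "a i" z] using assms(1) \<sigma>_nonneg
    by (intro sum.mono_neutral_right) (auto simp: row_dot_v less_le)
  also have "\<dots> = (\<Sum>j\<in>?J. dot d (a i) (v j) / s j * (s j * dot d z (v j)))"
    using s by (intro sum.cong) (auto simp: less_le)
  finally have "(dot d (a i) z)\<^sup>2 = (\<Sum>j\<in>?J. dot d (a i) (v j) / s j * (s j * dot d z (v j)))\<^sup>2"
    by simp
  also have "\<dots> \<le> (\<Sum>j\<in>?J. (dot d (a i) (v j) / s j)\<^sup>2) * (\<Sum>j\<in>?J. (s j * dot d z (v j))\<^sup>2)"
    by (rule Cauchy_Schwarz_ineq_sum)
  also have "(\<Sum>j\<in>?J. (dot d (a i) (v j) / s j)\<^sup>2) = (\<Sum>j\<in>?J. (dot d (a i) (v j))\<^sup>2 / ((\<sigma> j)\<^sup>2 + lam))"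
    using s by (intro sum.cong) (auto simp: power_divide)
  also have "(\<Sum>j\<in>?J. (s j * dot d z (v j))\<^sup>2) = (\<Sum>j\<in>?J. ((\<sigma> j)\<^sup>2 + lam) * (dot d z (v j))\<^sup>2)"
    using s by (intro sum.cong) (auto simp: power_mult_distrib)
  also have "\<dots> \<le> (\<Sum>j<d. ((\<sigma> j)\<^sup>2 + lam) * (dot d z (v j))\<^sup>2)"
    using assms(2) sub by (intro sum_mono2) auto
  also have "\<dots> = (\<Sum>l<n. (dot d (a l) z)\<^sup>2) + lam * dot d z z"
    using gram[of z z] parseval[of z z]
    by (simp add: power2_eq_square algebra_simps sum.distrib sum_distrib_left)
  finally show ?thesis
    using assms(2) by (simp add: mult_left_mono sum_nonneg)
qed

text \<open>The coordinate of the row along \<open>v j\<close> is \<open>\<sigma> j\<close> times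
  that of \<open>c\<close> along \<open>u j\<close>. Dividing its square by
  \<open>(\<sigma> j)\<^sup>2 + lam\<close> leaves at most the square of the latter, and Bessel's
  inequality applies.\<close>

lemma ridge_upper:
  assumes "i < n" "0 \<le> lam" and comb: "\<And>l. l < d \<Longrightarrow> a i l = (\<Sum>k<n. c k * a k l)"
  shows "(\<Sum>j | j < d \<and> \<sigma> j > 0. (dot d (a i) (v j))\<^sup>2 / ((\<sigma> j)\<^sup>2 + lam)) \<le> (\<Sum>k<n. (c k)\<^sup>2)"
proof -
  let ?J = "{j. j < d \<and> \<sigma> j > 0}"
  have sub: "?J \<subseteq> {..<d}" by auto
  have "(\<Sum>j\<in>?J. (dot d (a i) (v j))\<^sup>2 / ((\<sigma> j)\<^sup>2 + lam)) \<le> (\<Sum>j\<in>?J. (dot n c (u j))\<^sup>2)"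
  proof (rule sum_mono)
    fix j assume j: "j \<in> ?J"
    have "dot d (a i) (v j) = dot d (\<lambda>l. \<Sum>k<n. c k * a k l) (v j)"
      using comb by (intro dot_cong) auto
    also have "\<dots> = (\<Sum>k<n. c k * dot d (a k) (v j))" by (rule dot_sum_left)
    also have "\<dots> = (\<Sum>k<n. c k * (\<sigma> j * u j k))"
      using j by (intro sum.cong) (auto simp: row_dot_v)
    also have "\<dots> = \<sigma> j * dot n c (u j)"
      by (simp add: dot_def sum_distrib_left mult_ac)
    finally have "(dot d (a i) (v j))\<^sup>2 / ((\<sigma> j)\<^sup>2 + lam)
        = (dot n c (u j))\<^sup>2 * ((\<sigma> j)\<^sup>2 / ((\<sigma> j)\<^sup>2 + lam))"
      by (simp add: power_mult_distrib)
    also have "\<dots> \<le> (dot n c (u j))\<^sup>2 * 1"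
      using j assms(2) by (intro mult_left_mono) (auto simp: divide_le_eq_1 add_pos_nonneg)
    finally show "(dot d (a i) (v j))\<^sup>2 / ((\<sigma> j)\<^sup>2 + lam) \<le> (dot n c (u j))\<^sup>2" by simp
  qed
  also have "\<dots> \<le> dot n c c"
    using u_orthonormal finite_subset[OF sub] sub
    by (intro bessel) (auto simp: orthonormal_def)
  finally show ?thesis by (simp add: dot_def power2_eq_square)
qed

text \<open>A dimension count by double counting: the squared coefficients between the family and
  \<open>v\<close> sum to \<open>card I\<close>, but by Bessel to at most \<open>1\<close> for each
  of the \<open>k\<close> vectors \<open>v j\<close> involved.\<close>

lemma card_orthonormal_le:
  assumes "finite I" "orthonormal d I w" "k \<le> d"
    and zero: "\<And>q j. q \<in> I \<Longrightarrow> k \<le> j \<Longrightarrow> j < d \<Longrightarrow> dot d (w q) (v j) = 0"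
  shows "card I \<le> k"
proof -
  have "real (card I) = (\<Sum>q\<in>I. dot d (w q) (w q))"
    using assms(2) by (simp add: orthonormal_def)
  also have "\<dots> = (\<Sum>q\<in>I. \<Sum>j<k. (dot d (w q) (v j))\<^sup>2)"
  proof (rule sum.cong[OF refl])
    fix q assume "q \<in> I"
    then show "dot d (w q) (w q) = (\<Sum>j<k. (dot d (w q) (v j))\<^sup>2)"
      unfolding parseval[of "w q" "w q"] power2_eq_square[symmetric] using zero assms(3)
      by (intro sum.mono_neutral_right) auto
  qed
  also have "\<dots> = (\<Sum>j<k. \<Sum>q\<in>I. (dot d (v j) (w q))\<^sup>2)"
    by (subst sum.swap) (simp add: dot_commute)
  also have "\<dots> \<le> (\<Sum>j<k. dot d (v j) (v j))"
    by (intro sum_mono bessel assms)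
  also have "\<dots> = (\<Sum>j<k. 1)"
    using v_orthonormal assms(3) by (intro sum.cong) (auto simp: orthonormal_def)
  finally show ?thesis by simp
qed

text \<open>By \<open>one\<close>, each of the first \<open>k\<close> vectors \<open>v j\<close>
  lies in the span of \<open>w\<close>. The squared coefficients against them add up to
  \<open>k\<close>, the total squared norm of \<open>w\<close>, so nothing is left for the other
  \<open>v j\<close>.\<close>

lemma orthonormal_span_eq:
  assumes "orthonormal d {..<k} w" "k \<le> d"
    and one: "\<And>j. j < k \<Longrightarrow> (\<Sum>q<k. (dot d (w q) (v j))\<^sup>2) = 1"
    and "q < k" "k \<le> j" "j < d"
  shows "dot d (w q) (v j) = 0"
proof -
  have "real k = (\<Sum>q<k. dot d (w q) (w q))"
    using assms(1) by (simp add: orthonormal_def)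
  also have "\<dots> = (\<Sum>q<k. (\<Sum>j<k. (dot d (w q) (v j))\<^sup>2) + (\<Sum>j\<in>{k..<d}. (dot d (w q) (v j))\<^sup>2))"
  proof -
    have "{..<d} = {..<k} \<union> {k..<d}" using assms(2) by auto
    then show ?thesis
      unfolding parseval[of "w q" "w q" for q] power2_eq_square[symmetric]
      by (simp add: sum.union_disjoint ivl_disj_int)
  qed
  also have "\<dots> = (\<Sum>j<k. \<Sum>q<k. (dot d (w q) (v j))\<^sup>2) + (\<Sum>q<k. \<Sum>j\<in>{k..<d}. (dot d (w q) (v j))\<^sup>2)"
    unfolding sum.distrib by (subst sum.swap) simp
  also have "(\<Sum>j<k. \<Sum>q<k. (dot d (w q) (v j))\<^sup>2) = real k"
    using one by simp
  finally have "(\<Sum>q<k. \<Sum>j\<in>{k..<d}. (dot d (w q) (v j))\<^sup>2) = 0" by simp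
  then have "(\<Sum>j\<in>{k..<d}. (dot d (w q) (v j))\<^sup>2) = 0"
    using assms(4) by (subst (asm) sum_nonneg_eq_0_iff) (auto intro: sum_nonneg)
  then show ?thesis
    using assms(5,6) by (subst (asm) sum_nonneg_eq_0_iff) auto
qed

end

section \<open>Top singular subspace of a matrix with dominant orthogonal rows\<close>

text \<open>Alice's rows come first, pairwise orthogonal and each longer than Bob's row
  \<open>k\<close>; zero rows follow. All conclusions below hold for every choice of
  decomposition.\<close>

locale dominant_rows = svd +
  fixes k :: nat
  assumes k: "k < n" "k \<le> d"
    and pairwise: "p < k \<Longrightarrow> q < k \<Longrightarrow> p \<noteq> q \<Longrightarrow> dot d (a p) (a q) = 0"
    and dominant: "q < k \<Longrightarrow> dot d (a k) (a k) < dot d (a q) (a q)"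
    and rest: "k < i \<Longrightarrow> i < n \<Longrightarrow> l < d \<Longrightarrow> a i l = 0"
begin

lemma norm_pos: "q < k \<Longrightarrow> 0 < dot d (a q) (a q)"
  using dominant[of q] dot_self_nonneg[of d "a k"] by linarith

lemma sum_rows: "(\<Sum>i<n. dot d (a i) x * dot d (a i) y)
    = (\<Sum>q<k. dot d (a q) x * dot d (a q) y) + dot d (a k) x * dot d (a k) y"
proof -
  have "(\<Sum>i<n. dot d (a i) x * dot d (a i) y) = (\<Sum>i<Suc k. dot d (a i) x * dot d (a i) y)"
    using k rest by (intro sum.mono_neutral_right) (auto simp: dot_def)
  then show ?thesis by simp
qed

text \<open>The eigenvector equation for \<open>v j\<close>, paired with \<open>a q\<close>: among
  Alice's rows only \<open>q\<close> itself survives, and Bob's row adds a coupling term.\<close>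

lemma top_row_dot_v:
  assumes "j < d" "q < k"
  shows "dot d (a q) (a q) * dot d (a q) (v j) + dot d (a k) (a q) * dot d (a k) (v j)
    = (\<sigma> j)\<^sup>2 * dot d (a q) (v j)"
proof -
  have "(\<Sum>p<k. dot d (a p) (a q) * dot d (a p) (v j))
      = (\<Sum>p<k. if p = q then dot d (a p) (a q) * dot d (a p) (v j) else 0)"
    using pairwise assms(2) by (intro sum.cong) auto
  with gram_v[OF assms(1), of "a q"] show ?thesis
    using assms(2) by (simp add: sum_rows)
qed

definition w :: "nat \<Rightarrow> nat \<Rightarrow> real" where
  "w q l = a q l / sqrt (dot d (a q) (a q))"

lemma dot_w: "dot d (w q) y = dot d (a q) y / sqrt (dot d (a q) (a q))"
  by (simp add: dot_def w_def sum_divide_distrib)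

lemma w_orthonormal: "orthonormal d {..<k} w"
proof -
  have "dot d (w p) (w q) = of_bool (p = q)" if "p < k" "q < k" for p q
  proof (cases "p = q")
    case True
    then show ?thesis using norm_pos[OF that(1)]
      by (simp add: dot_w dot_commute[of d "a q" "w q"])
  next
    case False
    have "dot d (w p) (w q) = dot d (a q) (a p) / sqrt (dot d (a q) (a q)) / sqrt (dot d (a p) (a p))"
      by (simp add: dot_w dot_commute[of d "a p" "w q"])
    with pairwise[OF that(2,1)] False show ?thesis by simp
  qed
  then show ?thesis by (simp add: orthonormal_def)
qed

lemma dot_w_zero_iff: "q < k \<Longrightarrow> dot d (w q) y = 0 \<longleftrightarrow> dot d (a q) y = 0"
  using norm_pos[of q] by (auto simp: dot_w)

text \<open>Without coupling to Bob's row, \<open>a q\<close> meets \<open>v j\<close> only if its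
  squared norm is \<open>(\<sigma> j)\<^sup>2\<close>. So the squared coefficients of each top
  \<open>v j\<close> along the normalized rows sum to \<open>1\<close>, and the two
  \<open>k\<close>-dimensional spans coincide.\<close>

lemma top_subspace:
  assumes j: "\<And>j. j < k \<Longrightarrow> 0 < \<sigma> j" "\<And>j. j < k \<Longrightarrow> dot d (a k) (v j) = 0"
    and "q < k" "k \<le> j" "j < d"
  shows "dot d (a q) (v j) = 0"
proof -
  have "(\<Sum>q<k. (dot d (w q) (v j))\<^sup>2) = 1" if "j < k" for j
  proof -
    have jd: "j < d" using that k by simp
    have eq: "dot d (a q) (a q) * dot d (a q) (v j) = (\<sigma> j)\<^sup>2 * dot d (a q) (v j)" if "q < k" for q
      using top_row_dot_v[OF jd that] j(2)[OF \<open>j < k\<close>] by simp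
    have "(\<Sum>q<k. (dot d (w q) (v j))\<^sup>2) = (\<Sum>q<k. (dot d (a q) (v j))\<^sup>2 / (\<sigma> j)\<^sup>2)"
      using eq norm_pos by (intro sum.cong refl) (auto simp: dot_w power_divide less_imp_le)
    also have "\<dots> = (\<Sum>i<n. dot d (a i) (v j) * dot d (a i) (v j)) / (\<sigma> j)\<^sup>2"
      by (simp add: sum_rows j(2)[OF that] power2_eq_square sum_divide_distrib)
    also have "\<dots> = 1"
      using gram_v[OF jd, of "v j"] v_orthonormal jd j(1)[OF that] by (simp add: orthonormal_def)
    finally show ?thesis .
  qed
  from orthonormal_span_eq[OF w_orthonormal k(2) this assms(3-5)] show ?thesis
    using dot_w_zero_iff[OF assms(3)] by simp
qed

text \<open>Row \<open>k\<close> now satisfies the eigenvector equation by itself, with a value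
  below every \<open>(\<sigma> j)\<^sup>2\<close> for \<open>j < k\<close>. Hence it is orthogonal
  to the top singular vectors, and \<open>top_subspace\<close> applies.\<close>

lemma orthogonal_case:
  assumes "\<And>q. q < k \<Longrightarrow> dot d (a k) (a q) = 0"
  shows "j < k \<Longrightarrow> dot d (a k) (v j) = 0"
    and "q < k \<Longrightarrow> k \<le> j \<Longrightarrow> j < d \<Longrightarrow> dot d (a q) (v j) = 0"
proof -
  \<comment> \<open>Otherwise the \<open>k\<close> orthonormal vectors \<open>w q\<close> would be
    orthogonal to all \<open>v i\<close> with \<open>i \<ge> j\<close> and fit into
    \<open>j < k\<close> dimensions.\<close>
  have \<sigma>: "dot d (a k) (a k) < (\<sigma> j)\<^sup>2" if "j < k" for j
  proof (rule ccontr)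
    assume neg: "\<not> ?thesis"
    have "dot d (w q) (v i) = 0" if qi: "q < k" "j \<le> i" "i < d" for q i
    proof -
      have "(\<sigma> i)\<^sup>2 \<le> (\<sigma> j)\<^sup>2"
        using \<sigma>_antimono[OF qi(2,3)] \<sigma>_nonneg[OF qi(3)] by (intro power_mono)
      with neg dominant[OF qi(1)] have "(\<sigma> i)\<^sup>2 \<noteq> dot d (a q) (a q)" by simp
      with top_row_dot_v[OF qi(3,1)] assms[OF qi(1)] show ?thesis
        by (simp add: dot_w_zero_iff[OF qi(1)])
    qed
    from card_orthonormal_le[OF _ w_orthonormal _ this, of j] that k show False by simp
  qed
  have zero: "dot d (a k) (v j) = 0" if "j < k" for j
  proof -
    have "j < d" using that k by simp
    have "(\<Sum>q<k. dot d (a q) (a k) * dot d (a q) (v j)) = 0"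
      using assms by (intro sum.neutral) (simp add: dot_commute)
    with gram_v[OF \<open>j < d\<close>, of "a k"]
    have "dot d (a k) (a k) * dot d (a k) (v j) = (\<sigma> j)\<^sup>2 * dot d (a k) (v j)"
      by (simp add: sum_rows)
    with \<sigma>[OF that] show ?thesis by auto
  qed
  have pos: "0 < \<sigma> j" if "j < k" for j
    using \<sigma>[OF that] dot_self_nonneg[of d "a k"] \<sigma>_nonneg[of j] that k
    by (cases "\<sigma> j = 0") auto
  show "j < k \<Longrightarrow> dot d (a k) (v j) = 0"
    and "q < k \<Longrightarrow> k \<le> j \<Longrightarrow> j < d \<Longrightarrow> dot d (a q) (v j) = 0"
    using zero top_subspace[OF pos zero] by auto
qed

text \<open>If row \<open>k\<close> were orthogonal to all top singular vectors,
  \<open>top_subspace\<close> would put Alice's rows into their span, and Parseval would make row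
  \<open>k\<close> orthogonal to \<open>a q\<close>. A zero among the first \<open>k\<close>
  singular values is excluded by dimension.\<close>

lemma oblique_case_leverage:
  assumes "q < k" "dot d (a k) (a q) \<noteq> 0"
  shows "\<exists>j<k. 0 < \<sigma> j \<and> dot d (a k) (v j) \<noteq> 0"
proof (rule ccontr)
  assume neg: "\<not> ?thesis"
  have pos: "0 < \<sigma> j" if "j < k" for j
  proof (rule ccontr)
    assume "\<not> ?thesis"
    then have j0: "\<sigma> j = 0" using \<sigma>_nonneg[of j] that k by simp
    have "dot d (w q) (v i) = 0" if qi: "q < k" "j \<le> i" "i < d" for q i
    proof -
      have "\<sigma> i = 0" using \<sigma>_antimono[OF qi(2,3)] \<sigma>_nonneg[OF qi(3)] j0 by simp
      with row_dot_v[of q i] qi k show ?thesis by (simp add: dot_w_zero_iff)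
    qed
    from card_orthonormal_le[OF _ w_orthonormal _ this, of j] that k show False by simp
  qed
  have zero: "dot d (a k) (v j) = 0" if "j < k" for j
    using neg pos that by blast
  have "dot d (a k) (a q) = (\<Sum>j<d. dot d (a k) (v j) * dot d (a q) (v j))"
    by (rule parseval)
  also have "\<dots> = 0"
    using zero top_subspace[OF pos zero assms(1)] by (intro sum.neutral) (metis lessThan_iff mult_eq_0_iff not_le)
  finally show False using assms(2) by simp
qed

text \<open>If Alice's rows all lay in the top subspace, the coupling term would force row
  \<open>k\<close> into it as well. But her \<open>k\<close> rows already fill it and vanish at
  coordinate \<open>c\<close>, where row \<open>k\<close> does not.\<close>

lemma oblique_case_distance:
  assumes "q < k" "dot d (a k) (a q) \<noteq> 0"
    and c: "c < d" "\<And>p. p < k \<Longrightarrow> a p c = 0" "a k c \<noteq> 0"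
  shows "\<exists>p<k. \<exists>j\<in>{k..<d}. dot d (a p) (v j) \<noteq> 0"
proof (rule ccontr)
  assume neg: "\<not> ?thesis"
  then have zero: "dot d (a p) (v j) = 0" if "p < k" "k \<le> j" "j < d" for p j
    using that by auto
  have \<eta>: "dot d (a k) (v j) = 0" if "k \<le> j" "j < d" for j
    using top_row_dot_v[OF that(2) assms(1)] zero[OF assms(1) that] assms(2) by simp
  \<comment> \<open>The unit vector at \<open>c\<close> extends the normalized rows to
    \<open>k + 1\<close> orthonormal vectors. Bessel's inequality, summed over the top
    \<open>v j\<close>, leaves no room for \<open>e\<close>, so it is orthogonal to all of
    them.\<close>
  define e :: "nat \<Rightarrow> real" where "e l = of_bool (l = c)" for l
  have e_dot: "dot d y e = y c" for y
  proof -
    have "dot d y e = (\<Sum>l<d. if l = c then y l else 0)"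
      by (simp add: dot_def e_def)
    then show ?thesis using c(1) by simp
  qed
  define w' where "w' p = (if p = k then e else w p)" for p
  have "dot d (w' p) (w' q) = of_bool (p = q)" if "p \<le> k" "q \<le> k" for p q
  proof -
    have "dot d e (w i) = 0" "dot d (w i) e = 0" if "i < k" for i
      using c(2)[OF that] by (simp_all add: dot_commute[of d e "w i"] e_dot w_def)
    moreover have "dot d e e = 1" unfolding e_dot by (simp add: e_def)
    ultimately show ?thesis using that w_orthonormal
      by (auto simp: w'_def orthonormal_def)
  qed
  then have w': "orthonormal d {..k} w'" by (simp add: orthonormal_def)
  have "(\<Sum>j<k. (dot d e (v j))\<^sup>2) + real k
      = (\<Sum>j<k. (dot d e (v j))\<^sup>2) + (\<Sum>q<k. \<Sum>j<k. (dot d (w q) (v j))\<^sup>2)"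
  proof -
    have "(\<Sum>j<k. (dot d (w q) (v j))\<^sup>2) = 1" if "q < k" for q
    proof -
      have "(\<Sum>j<k. (dot d (w q) (v j))\<^sup>2) = (\<Sum>j<d. (dot d (w q) (v j))\<^sup>2)"
        using zero[OF that] k dot_w_zero_iff[OF that] by (intro sum.mono_neutral_left) auto
      also have "\<dots> = dot d (w q) (w q)" by (simp add: parseval[of "w q" "w q"] power2_eq_square)
      finally show ?thesis using w_orthonormal that by (simp add: orthonormal_def)
    qed
    then show ?thesis by simp
  qed
  also have "\<dots> = (\<Sum>j<k. \<Sum>q\<le>k. (dot d (v j) (w' q))\<^sup>2)"
    by (subst (2) sum.swap) (simp add: w'_def dot_commute sum.distrib flip: lessThan_Suc_atMost)
  also have "\<dots> \<le> (\<Sum>j<k. dot d (v j) (v j))"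
    by (intro sum_mono bessel w') simp
  also have "\<dots> = (\<Sum>j<k. 1)"
    using v_orthonormal k by (intro sum.cong) (auto simp: orthonormal_def)
  finally have "(\<Sum>j<k. (dot d e (v j))\<^sup>2) \<le> 0" by simp
  then have "(\<Sum>j<k. (dot d e (v j))\<^sup>2) = 0"
    by (intro antisym sum_nonneg) auto
  then have e0: "dot d e (v j) = 0" if "j < k" for j
    using that by (subst (asm) sum_nonneg_eq_0_iff) auto
  have "a k c = dot d (a k) e" by (simp add: e_dot)
  also have "\<dots> = (\<Sum>j<d. dot d (a k) (v j) * dot d e (v j))" by (rule parseval)
  also have "\<dots> = 0" using e0 \<eta> by (intro sum.neutral) (metis lessThan_iff mult_eq_0_iff not_le)
  finally show False using c(3) by simp
qed

end

lemma thin_svd_svd: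
  assumes A: "A \<in> carrier_mat n d" and svd: "thin_svd A U \<sigma> V"
  shows "svd n d (\<lambda>i l. A $$ (i, l)) (\<lambda>j i. U $$ (i, j)) (\<lambda>j l. V $$ (l, j)) \<sigma>"
proof -
  have U: "U \<in> carrier_mat n d" and V: "V \<in> carrier_mat d d"
    and UU: "transpose_mat U * U = 1\<^sub>m d" and VV: "transpose_mat V * V = 1\<^sub>m d"
    and AU: "A = U * mat_diag d \<sigma> * transpose_mat V"
    using svd A by (auto simp: thin_svd_def)
  have VV': "V * transpose_mat V = 1\<^sub>m d"
    using mat_mult_left_right_inverse[OF _ V VV] V by simp
  have AV: "A * V = U * mat_diag d \<sigma>"
  proof -
    have "A * V = U * mat_diag d \<sigma> * (transpose_mat V * V)"
      unfolding AU using U V by (intro assoc_mult_mat) (auto simp: mat_diag_def)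
    then show ?thesis using U unfolding VV by (simp add: mat_diag_def)
  qed
  have idx: "(\<Sum>l<d. V $$ (l, i) * V $$ (l, j)) = of_bool (i = j)" if "i < d" "j < d" for i j
    using arg_cong[OF VV, of "\<lambda>M. M $$ (i, j)"] that V
    by (auto simp: scalar_prod_def atLeast0LessThan)
  have idx': "(\<Sum>l<d. V $$ (i, l) * V $$ (j, l)) = of_bool (i = j)" if "i < d" "j < d" for i j
    using arg_cong[OF VV', of "\<lambda>M. M $$ (i, j)"] that V
    by (auto simp: scalar_prod_def atLeast0LessThan)
  have idu: "(\<Sum>l<n. U $$ (l, i) * U $$ (l, j)) = of_bool (i = j)" if "i < d" "j < d" for i j
    using arg_cong[OF UU, of "\<lambda>M. M $$ (i, j)"] that U
    by (auto simp: scalar_prod_def atLeast0LessThan)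
  have row: "(\<Sum>l<d. A $$ (i, l) * V $$ (l, j)) = \<sigma> j * U $$ (i, j)" if "i < n" "j < d" for i j
  proof -
    have "(\<Sum>l<d. A $$ (i, l) * V $$ (l, j)) = (A * V) $$ (i, j)"
      using that A V by (auto simp: scalar_prod_def atLeast0LessThan)
    also have "\<dots> = \<sigma> j * U $$ (i, j)"
      unfolding AV using that U by (simp add: mat_diag_mult_right[OF U])
    finally show ?thesis .
  qed
  show ?thesis
    using svd A idx idx' idu row
    by unfold_locales (auto simp: thin_svd_def orthonormal_def dot_def)
qed

lemma row_scalar_prod_col:
  assumes "A \<in> carrier_mat n d" "thin_svd A U \<sigma> V" "i < n" "j < d"
  shows "row A i \<bullet> col V j = dot d (\<lambda>l. A $$ (i, l)) (\<lambda>l. V $$ (l, j))"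
  using assms by (auto simp: thin_svd_def scalar_prod_def dot_def atLeast0LessThan)

section \<open>Existence of singular value decompositions by maximization\<close>

lemma dot_combine_left: "dot d (\<lambda>l. c * x l + s * y l) z = c * dot d x z + s * dot d y z"
  by (simp add: dot_def sum.distrib sum_distrib_left algebra_simps)

lemma dot_combine_right: "dot d z (\<lambda>l. c * x l + s * y l) = c * dot d z x + s * dot d z y"
  by (simp add: dot_commute[of d z] dot_combine_left)

lemma dot_difference_left: "dot d (\<lambda>l. c * x l - s * y l) z = c * dot d x z - s * dot d y z"
  using dot_combine_left[of d c x "- s" y z] by simp

lemma dot_difference_right: "dot d z (\<lambda>l. c * x l - s * y l) = c * dot d z x - s * dot d z y"
  using dot_combine_right[of d z c x "- s" y] by simp

text \<open>A Givens rotation in the plane of \<open>v p\<close> and \<open>v q\<close>, with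
  \<open>c\<close> and \<open>s\<close> as cosine and sine.\<close>

definition rotate_pair :: "nat \<Rightarrow> nat \<Rightarrow> real \<Rightarrow> real \<Rightarrow> (nat \<Rightarrow> nat \<Rightarrow> real) \<Rightarrow> nat \<Rightarrow> nat \<Rightarrow> real" where
  "rotate_pair p q c s v =
     v(p := (\<lambda>l. c * v p l + s * v q l), q := (\<lambda>l. c * v q l - s * v p l))"

lemma orthonormal_rotate_pair:
  assumes "orthonormal d J v" "p \<in> J" "q \<in> J" "p \<noteq> q" "c\<^sup>2 + s\<^sup>2 = 1"
  shows "orthonormal d J (rotate_pair p q c s v)"
  unfolding orthonormal_def
proof (intro ballI)
  fix i j assume ij: "i \<in> J" "j \<in> J"
  have o: "dot d (v i) (v j) = of_bool (i = j)" if "i \<in> J" "j \<in> J" for i j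
    using assms(1) that by (simp add: orthonormal_def)
  have cs: "c * c + s * s = 1" using assms(5) by (simp add: power2_eq_square)
  show "dot d (rotate_pair p q c s v i) (rotate_pair p q c s v j) = of_bool (i = j)"
    using o ij assms(2-4) cs
    by (auto simp: rotate_pair_def dot_combine_left dot_combine_right
        dot_difference_left dot_difference_right)
qed

definition energy :: "nat \<Rightarrow> nat \<Rightarrow> (nat \<Rightarrow> nat \<Rightarrow> real) \<Rightarrow> (nat \<Rightarrow> real) \<Rightarrow> real" where
  "energy n d a z = (\<Sum>i<n. (dot d (a i) z)\<^sup>2)"

lemma energy_combine: "energy n d a (\<lambda>l. c * x l + s * y l)
    = c\<^sup>2 * energy n d a x + 2 * c * s * (\<Sum>i<n. dot d (a i) x * dot d (a i) y) + s\<^sup>2 * energy n d a y"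
  unfolding energy_def dot_combine_right
  by (simp add: power2_eq_square algebra_simps sum.distrib sum_distrib_left)

text \<open>Orthonormal systems form a closed subset of a product of intervals, compact by
  Tychonoff's theorem, and the weighted energy is continuous.\<close>

lemma exists_maximal_orthonormal:
  fixes d n :: nat and a :: "nat \<Rightarrow> nat \<Rightarrow> real" and weight :: "nat \<Rightarrow> real"
  obtains v where "orthonormal d {..<d} v"
    and "\<And>v'. orthonormal d {..<d} v' \<Longrightarrow>
      (\<Sum>j<d. weight j * energy n d a (v' j)) \<le> (\<Sum>j<d. weight j * energy n d a (v j))"
proof -
  let ?K = "UNIV \<rightarrow>\<^sub>E {-1..1} :: (nat \<times> nat \<Rightarrow> real) set"
  define S where "S = ?K \<inter> (\<Inter>i\<in>{..<d}. \<Inter>j\<in>{..<d}. {f. (\<Sum>l<d. f (i, l) * f (j, l)) = of_bool (i = j)})"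
  define F where "F f = (\<Sum>j<d. weight j * (\<Sum>i<n. (\<Sum>l<d. a i l * f (j, l))\<^sup>2))" for f :: "nat \<times> nat \<Rightarrow> real"
  have "compactin (product_topology (\<lambda>_. euclidean) UNIV) ?K"
    by (subst compactin_PiE) auto
  then have "compact ?K"
    by (simp add: euclidean_product_topology)
  moreover have "closed {f :: nat \<times> nat \<Rightarrow> real. (\<Sum>l<d. f (i, l) * f (j, l)) = of_bool (i = j)}" for i j
    by (intro closed_Collect_eq continuous_intros continuous_on_product_coordinates)
  ultimately have comp: "compact S"
    unfolding S_def by (intro compact_Int_closed closed_INT) auto
  have mem: "(\<lambda>(j, l). if j < d \<and> l < d then v j l else 0) \<in> S" if "orthonormal d {..<d} v" for v
  proof -
    have sq: "(\<Sum>l<d. (v j l)\<^sup>2) = 1" if "j < d" for j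
      using \<open>orthonormal d {..<d} v\<close> that by (simp add: orthonormal_def dot_def power2_eq_square)
    have "\<bar>v j l\<bar> \<le> 1" if "j < d" "l < d" for j l
    proof -
      have "(v j l)\<^sup>2 \<le> (\<Sum>l<d. (v j l)\<^sup>2)" using that by (intro member_le_sum) auto
      then show ?thesis using sq[OF that(1)] by (simp add: abs_square_le_1)
    qed
    then have "v j l \<in> {-1..1}" if "j < d" "l < d" for j l
      using that by (simp add: abs_le_iff minus_le_iff)
    then show ?thesis
      using that by (auto simp: S_def orthonormal_def dot_def)
  qed
  have "orthonormal d {..<d} (\<lambda>j l. of_bool (j = l))"
    by (auto simp: orthonormal_def dot_def intro!: sum.neutral)
  then have "S \<noteq> {}" using mem by blast
  moreover have "continuous_on S F"
    unfolding F_def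
    by (intro continuous_intros continuous_on_subset[OF continuous_on_product_coordinates]) auto
  ultimately obtain f where f: "f \<in> S" "\<And>g. g \<in> S \<Longrightarrow> F g \<le> F f"
    using continuous_attains_sup[OF comp] by blast
  show ?thesis
  proof (rule that[of "\<lambda>j l. f (j, l)"])
    show "orthonormal d {..<d} (\<lambda>j l. f (j, l))"
      using f(1) by (simp add: S_def orthonormal_def dot_def)
    fix v' assume "orthonormal d {..<d} v'"
    from f(2)[OF mem[OF this]]
    show "(\<Sum>j<d. weight j * energy n d a (v' j)) \<le> (\<Sum>j<d. weight j * energy n d a (\<lambda>l. f (j, l)))"
      by (simp add: F_def energy_def dot_def)
  qed
qed

text \<open>With strictly decreasing weights, the weighted energy cannot be improved by rotating a pair of
  basis vectors. To first order in the angle this forces their images to be orthogonal, and a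
  rotation by a right angle shows that their energies are in decreasing order.\<close>

lemma exists_orthogonal_images:
  obtains v where "orthonormal d {..<d} v"
    and "\<And>p q. p < d \<Longrightarrow> q < d \<Longrightarrow> p \<noteq> q \<Longrightarrow> (\<Sum>i<n. dot d (a i) (v p) * dot d (a i) (v q)) = 0"
    and "\<And>p q. p \<le> q \<Longrightarrow> q < d \<Longrightarrow> energy n d a (v q) \<le> energy n d a (v p)"
proof -
  define weight where "weight j = real d - real j" for j
  obtain v where v: "orthonormal d {..<d} v"
    and max: "\<And>v'. orthonormal d {..<d} v' \<Longrightarrow>
      (\<Sum>j<d. weight j * energy n d a (v' j)) \<le> (\<Sum>j<d. weight j * energy n d a (v j))"
    using exists_maximal_orthonormal[where d = d and weight = weight and n = n and a = a] by blast
  define B where "B p q = (\<Sum>i<n. dot d (a i) (v p) * dot d (a i) (v q))" for p q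
  define E where "E p = energy n d a (v p)" for p
  \<comment> \<open>A rotation preserves the sum of the two energies, so the objective changes by
    the gain at \<open>p\<close> times \<open>weight p - weight q > 0\<close>. At a maximum this
    gain cannot be positive.\<close>
  have rot: "c\<^sup>2 * E p + 2 * c * s * B p q + s\<^sup>2 * E q \<le> E p"
    if pq: "p < q" "q < d" and cs: "c\<^sup>2 + s\<^sup>2 = 1" for p q c s
  proof -
    define v' where "v' = rotate_pair p q c s v"
    have "orthonormal d {..<d} v'"
      unfolding v'_def using pq cs by (intro orthonormal_rotate_pair v) auto
    from max[OF this] have "(\<Sum>j<d. weight j * (energy n d a (v' j) - E j)) \<le> 0"
      by (simp add: E_def sum_subtractf algebra_simps)
    moreover have "(\<Sum>j<d. weight j * (energy n d a (v' j) - E j))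
        = (\<Sum>j\<in>{p, q}. weight j * (energy n d a (v' j) - E j))"
      using pq by (intro sum.mono_neutral_right) (auto simp: v'_def rotate_pair_def E_def)
    moreover have "energy n d a (v' p) = c\<^sup>2 * E p + 2 * c * s * B p q + s\<^sup>2 * E q"
      using pq by (simp add: v'_def rotate_pair_def energy_combine E_def B_def)
    moreover have "energy n d a (v' q) = s\<^sup>2 * E p - 2 * c * s * B p q + c\<^sup>2 * E q"
      using energy_combine[of n d a "- s" "v p" c "v q"] pq
      by (simp add: v'_def rotate_pair_def E_def B_def algebra_simps)
    ultimately have "weight p * (c\<^sup>2 * E p + 2 * c * s * B p q + s\<^sup>2 * E q - E p)
        + weight q * (s\<^sup>2 * E p - 2 * c * s * B p q + c\<^sup>2 * E q - E q) \<le> 0"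
      using pq by simp
    moreover have c2: "c\<^sup>2 = 1 - s\<^sup>2" using cs by simp
    have "s\<^sup>2 * E p - 2 * c * s * B p q + c\<^sup>2 * E q - E q
        = - (c\<^sup>2 * E p + 2 * c * s * B p q + s\<^sup>2 * E q - E p)"
      unfolding c2 by (simp add: algebra_simps)
    ultimately have "weight p * (c\<^sup>2 * E p + 2 * c * s * B p q + s\<^sup>2 * E q - E p)
        + weight q * - (c\<^sup>2 * E p + 2 * c * s * B p q + s\<^sup>2 * E q - E p) \<le> 0"
      by (simp only:)
    moreover have "weight p * X + weight q * - X = (weight p - weight q) * X" for X
      by (simp add: left_diff_distrib)
    ultimately have "(weight p - weight q) * (c\<^sup>2 * E p + 2 * c * s * B p q + s\<^sup>2 * E q - E p) \<le> 0"
      by (simp only:)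
    moreover have "weight p - weight q > 0" using pq by (simp add: weight_def)
    ultimately show ?thesis by (simp add: mult_le_0_iff)
  qed
  have mono: "E q \<le> E p" if "p < q" "q < d" for p q
    using rot[OF that, of 0 1] by simp
  have zero: "B p q = 0" if pq: "p < q" "q < d" for p q
  proof (rule ccontr)
    assume nz: "B p q \<noteq> 0"
    define M where "M = E p - E q"
    have M: "0 \<le> M" using mono[OF pq] by (simp add: M_def)
    \<comment> \<open>\<open>t\<close> is the tangent of the angle: the rotation has cosine
      \<open>1 / r\<close> and sine \<open>t / r\<close>.\<close>
    have le: "2 * t * B p q \<le> t\<^sup>2 * M" for t
    proof -
      define r where "r = sqrt (1 + t\<^sup>2)"
      have r: "r\<^sup>2 = 1 + t\<^sup>2" "r > 0" by (auto simp: r_def add_pos_nonneg)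
      have "(1 / r)\<^sup>2 + (t / r)\<^sup>2 = 1" using r
        by (simp add: power_divide add_divide_distrib[symmetric])
          (metis less_irrefl zero_power2 power_eq_0_iff)
      from rot[OF pq this] have "(E p + 2 * t * B p q + t\<^sup>2 * E q) / r\<^sup>2 \<le> E p"
        by (simp add: power_divide add_divide_distrib power2_eq_square mult_ac)
      then have "E p + 2 * t * B p q + t\<^sup>2 * E q \<le> E p * (1 + t\<^sup>2)"
        using r by (subst (asm) pos_divide_le_eq) (simp_all add: add_pos_nonneg)
      then show ?thesis by (simp add: M_def algebra_simps)
    qed
    \<comment> \<open>For this \<open>t\<close> the linear term beats the quadratic one; the
      \<open>1\<close> in \<open>M + 1\<close> covers \<open>M = 0\<close>.\<close>
    from le[of "B p q / (M + 1)"] have "2 * (B p q)\<^sup>2 / (M + 1) \<le> (B p q)\<^sup>2 * M / (M + 1)\<^sup>2"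
      by (simp add: power_divide power2_eq_square)
    then have "2 * (B p q)\<^sup>2 * (M + 1) \<le> (B p q)\<^sup>2 * M"
      using M by (simp add: divide_simps power2_eq_square) 
    then have "(B p q)\<^sup>2 * (M + 2) \<le> 0" by (simp add: algebra_simps)
    then show False using nz M by (simp add: mult_le_0_iff)
  qed
  have B_sym: "B p q = B q p" for p q by (simp add: B_def mult.commute)
  show ?thesis
  proof (rule that[OF v])
    show "(\<Sum>i<n. dot d (a i) (v p) * dot d (a i) (v q)) = 0" if "p < d" "q < d" "p \<noteq> q" for p q
      using zero[of p q] zero[of q p] B_sym[of p q] that unfolding B_def
      by (cases "p < q") auto
    show "energy n d a (v q) \<le> energy n d a (v p)" if "p \<le> q" "q < d" for p q
      using mono[of p q] that by (cases "p = q") (auto simp: E_def)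
  qed
qed

text \<open>Injectivity makes all singular values positive, so the columns of \<open>U\<close> are
  the images of the \<open>v j\<close> divided by \<open>\<sigma> j\<close>. Vectors are functions
  on all of \<open>nat\<close>, hence \<open>dot d z z = 0\<close> in place of
  \<open>z = 0\<close>.\<close>

lemma exists_thin_svd:
  assumes A: "A \<in> carrier_mat n d"
    and inj: "\<And>z. (\<And>i. i < n \<Longrightarrow> dot d (\<lambda>l. A $$ (i, l)) z = 0) \<Longrightarrow> dot d z z = 0"
  shows "\<exists>U \<sigma> V. thin_svd A U \<sigma> V"
proof -
  define a where "a i l = A $$ (i, l)" for i l
  obtain v where v: "orthonormal d {..<d} v"
    and orth: "\<And>p q. p < d \<Longrightarrow> q < d \<Longrightarrow> p \<noteq> q \<Longrightarrow> (\<Sum>i<n. dot d (a i) (v p) * dot d (a i) (v q)) = 0"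
    and mono: "\<And>p q. p \<le> q \<Longrightarrow> q < d \<Longrightarrow> energy n d a (v q) \<le> energy n d a (v p)"
    using exists_orthogonal_images[where d = d and n = n and a = a] by blast
  define \<sigma> where "\<sigma> j = sqrt (energy n d a (v j))" for j
  have e_nonneg: "0 \<le> energy n d a z" for z by (simp add: energy_def sum_nonneg)
  have \<sigma>_sq: "\<sigma> j * \<sigma> j = energy n d a (v j)" for j
    using e_nonneg[of "v j"] by (simp add: \<sigma>_def)
  have \<sigma>_pos: "0 < \<sigma> j" if "j < d" for j
  proof -
    have "energy n d a (v j) \<noteq> 0"
    proof
      assume "energy n d a (v j) = 0"
      then have "dot d (a i) (v j) = 0" if "i < n" for i
        using that by (simp add: energy_def sum_nonneg_eq_0_iff)
      then have "dot d (v j) (v j) = 0" by (intro inj) (simp add: a_def[abs_def])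
      then show False using v that by (simp add: orthonormal_def)
    qed
    then show ?thesis using e_nonneg[of "v j"] by (simp add: \<sigma>_def)
  qed
  define U where "U = mat n d (\<lambda>(i, j). dot d (a i) (v j) / \<sigma> j)"
  define V where "V = mat d d (\<lambda>(l, j). v j l)"
  have U: "U \<in> carrier_mat n d" and V: "V \<in> carrier_mat d d" by (auto simp: U_def V_def)
  have VV: "transpose_mat V * V = 1\<^sub>m d"
    using v by (intro eq_matI) (auto simp: V_def scalar_prod_def orthonormal_def dot_def atLeast0LessThan)
  have VV': "V * transpose_mat V = 1\<^sub>m d"
    using mat_mult_left_right_inverse[OF _ V VV] V by simp
  have UU: "transpose_mat U * U = 1\<^sub>m d"
  proof (rule eq_matI)
    fix i j assume "i < dim_row (1\<^sub>m d :: real mat)" "j < dim_col (1\<^sub>m d :: real mat)"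
    then have ij: "i < d" "j < d" by auto
    have "(transpose_mat U * U) $$ (i, j) = (\<Sum>k<n. dot d (a k) (v i) * dot d (a k) (v j)) / (\<sigma> i * \<sigma> j)"
      using ij by (simp add: U_def scalar_prod_def atLeast0LessThan sum_divide_distrib)
    also have "\<dots> = of_bool (i = j)"
      using orth[OF ij] \<sigma>_sq[of j] \<sigma>_pos[OF ij(2)]
      by (auto simp: energy_def power2_eq_square)
    finally show "(transpose_mat U * U) $$ (i, j) = 1\<^sub>m d $$ (i, j)" using ij by simp
  qed (auto simp: U_def)
  have "U * mat_diag d \<sigma> = A * V"
  proof (rule eq_matI)
    fix i j assume "i < dim_row (A * V)" "j < dim_col (A * V)"
    then have ij: "i < n" "j < d" using A V by auto
    have "(U * mat_diag d \<sigma>) $$ (i, j) = U $$ (i, j) * \<sigma> j"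
      using ij by (simp add: mat_diag_mult_right[OF U])
    also have "\<dots> = dot d (a i) (v j)"
      using ij \<sigma>_pos[OF ij(2)] by (simp add: U_def)
    also have "\<dots> = (A * V) $$ (i, j)"
      using ij A by (auto simp: V_def scalar_prod_def dot_def a_def atLeast0LessThan)
    finally show "(U * mat_diag d \<sigma>) $$ (i, j) = (A * V) $$ (i, j)" .
  qed (use A U V in \<open>auto simp: mat_diag_def\<close>)
  then have "U * mat_diag d \<sigma> * transpose_mat V = A * (V * transpose_mat V)"
    using A V by (simp add: assoc_mult_mat[of A n d V d "transpose_mat V" d])
  then have "A = U * mat_diag d \<sigma> * transpose_mat V" using A unfolding VV' by simp
  moreover have "\<sigma> j \<le> \<sigma> i" if "i \<le> j" "j < d" for i j
    using mono[OF that] by (simp add: \<sigma>_def)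
  ultimately have "thin_svd A U \<sigma> V"
    using A U V UU VV \<sigma>_pos unfolding thin_svd_def by (auto simp: less_imp_le)
  then show ?thesis by blast
qed

section \<open>Largest singular value and stable rank\<close>

context svd
begin

text \<open>Together with \<open>energy_v\<close>, which gives equality at \<open>v 0\<close>, this
  describes \<open>\<sigma> 0\<close> by the matrix alone, so all decompositions share it.\<close>

lemma energy_le:
  assumes "0 < d"
  shows "energy n d a z \<le> (\<sigma> 0)\<^sup>2 * dot d z z"
proof -
  have "energy n d a z = (\<Sum>j<d. (\<sigma> j)\<^sup>2 * (dot d z (v j) * dot d z (v j)))"
    using gram[of z z] by (simp add: energy_def power2_eq_square)
  also have "\<dots> \<le> (\<Sum>j<d. (\<sigma> 0)\<^sup>2 * (dot d z (v j) * dot d z (v j)))"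
    using \<sigma>_antimono \<sigma>_nonneg by (intro sum_mono mult_right_mono power_mono) auto
  also have "\<dots> = (\<sigma> 0)\<^sup>2 * dot d z z"
    unfolding parseval[of z z] by (simp add: sum_distrib_left)
  finally show ?thesis .
qed

lemma energy_v:
  assumes "j < d"
  shows "energy n d a (v j) = (\<sigma> j)\<^sup>2"
  using gram_v[OF assms, of "v j"] v_orthonormal assms
  by (simp add: energy_def orthonormal_def power2_eq_square)

end

text \<open>\<open>largest_singular_value\<close> is a definite description, so existence and
  uniqueness come first. The value is nonzero by injectivity and cancels, leaving only the Frobenius
  norm.\<close>

lemma stable_rank_mult:
  assumes A: "A \<in> carrier_mat n d" and "0 < d"
    and inj: "\<And>z. (\<And>i. i < n \<Longrightarrow> dot d (\<lambda>l. A $$ (i, l)) z = 0) \<Longrightarrow> dot d z z = 0"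
  shows "stable_rank A / (2 * real d) * (largest_singular_value A)\<^sup>2 = (frobenius_norm A)\<^sup>2 / (2 * real d)"
proof -
  obtain U \<sigma> V where svd: "thin_svd A U \<sigma> V" using exists_thin_svd[OF A inj] by blast
  interpret svd n d "\<lambda>i l. A $$ (i, l)" "\<lambda>j i. U $$ (i, j)" "\<lambda>j l. V $$ (l, j)" \<sigma>
    by (rule thin_svd_svd[OF A svd])
  have le: "\<tau> 0 \<le> \<sigma>' 0" if 1: "thin_svd A U1 \<sigma>' V1" and 2: "thin_svd A U2 \<tau> V2" for U1 \<sigma>' V1 U2 \<tau> V2
  proof -
    interpret s1: svd n d "\<lambda>i l. A $$ (i, l)" "\<lambda>j i. U1 $$ (i, j)" "\<lambda>j l. V1 $$ (l, j)" \<sigma>'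
      by (rule thin_svd_svd[OF A 1])
    interpret s2: svd n d "\<lambda>i l. A $$ (i, l)" "\<lambda>j i. U2 $$ (i, j)" "\<lambda>j l. V2 $$ (l, j)" \<tau>
      by (rule thin_svd_svd[OF A 2])
    have "(\<tau> 0)\<^sup>2 \<le> (\<sigma>' 0)\<^sup>2"
      using s1.energy_le[OF \<open>0 < d\<close>, of "\<lambda>l. V2 $$ (l, 0)"] s2.energy_v[OF \<open>0 < d\<close>] s2.v_orthonormal \<open>0 < d\<close>
      by (simp add: orthonormal_def)
    then show ?thesis using s1.\<sigma>_nonneg[OF \<open>0 < d\<close>] by (rule power2_le_imp_le)
  qed
  have "largest_singular_value A = \<sigma> 0"
    unfolding largest_singular_value_def using svd le by (intro the_equality) (blast intro: antisym)+
  moreover have "\<sigma> 0 \<noteq> 0"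
  proof
    assume "\<sigma> 0 = 0"
    with row_dot_v[OF _ \<open>0 < d\<close>] have "dot d (\<lambda>l. V $$ (l, 0)) (\<lambda>l. V $$ (l, 0)) = 0"
      by (intro inj) simp
    then show False using v_orthonormal \<open>0 < d\<close> by (simp add: orthonormal_def)
  qed
  ultimately show ?thesis by (simp add: stable_rank_def)
qed

subsection \<open>Hard inputs\<close>

lemma uses_space_at_least_mono:
  "uses_space_at_least alg p D s \<Longrightarrow> s' \<le> s \<Longrightarrow> uses_space_at_least alg p D s'"
  unfolding uses_space_at_least_def by (meson order_trans)

text \<open>With less space than claimed, the number of memory records is at most
  \<open>2 powr (d / 8)\<close>, while the relative discrepancy is of order
  \<open>2 powr (- (m / 2))\<close> with \<open>m \<ge> d / 2 - 2\<close>.\<close>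

lemma pairing_space_bound:
  fixes M :: "alice_input \<Rightarrow> bob_input \<Rightarrow> real mat" and F :: "nat \<times> real \<Rightarrow> bool"
  defines "P \<equiv> \<lambda>m. alice_inputs m (m * 2 ^ m + 2)" and "Q \<equiv> \<lambda>m. bob_inputs m (m * 2 ^ m + 2) (2 ^ m)"
  assumes k: "0 < k" "k < n"
    and D: "\<And>a b. a \<in> P m \<Longrightarrow> b \<in> Q m \<Longrightarrow> M a b \<in> D" "D \<subseteq> carrier_mat n d'"
    and alice: "\<And>a b b' i. a \<in> P m \<Longrightarrow> b \<in> Q m \<Longrightarrow> b' \<in> Q m \<Longrightarrow> i < k \<Longrightarrow> row (M a b) i = row (M a b') i"
    and bob: "\<And>a a' b i. a \<in> P m \<Longrightarrow> a' \<in> P m \<Longrightarrow> b \<in> Q m \<Longrightarrow> k \<le> i \<Longrightarrow> i < n \<Longrightarrow> row (M a b) i = row (M a' b) i"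
    and solves: "solves_whp alg p D correct"
    and c0: "\<And>a b Y. a \<in> P m \<Longrightarrow> b \<in> Q m \<Longrightarrow> pairing a b = 0 \<Longrightarrow> correct (M a b) Y \<Longrightarrow> \<forall>z\<in>Y. \<not> F z"
    and c1: "\<And>a b Y. a \<in> P m \<Longrightarrow> b \<in> Q m \<Longrightarrow> pairing a b = 1 \<Longrightarrow> correct (M a b) Y \<Longrightarrow> \<exists>z\<in>Y. F z"
    and d: "d \<ge> 64" "real m \<ge> real d / 2 - 2" and "p \<ge> 1"
  shows "uses_space_at_least alg p D (1 / 32 * real d / real p)"
proof (rule ccontr)
  assume space: "\<not> ?thesis"
  define s where "s = 1 / 32 * real d / real p"
  define N :: nat where "N = 2 ^ m"
  define L where "L = m * N + 2"
  define T where "T = 2 ^ m * real L * real N ^ m"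
  have PQ: "P m = alice_inputs m L" "Q m = bob_inputs m L N" by (simp_all add: P_def Q_def L_def N_def)
  have m: "1 \<le> m" using d by (cases m) auto
  have T: "T > 0"
    unfolding T_def by (intro mult_pos_pos zero_less_power) (simp_all add: L_def N_def add_pos_nonneg)
  have s: "0 < s" using d \<open>p \<ge> 1\<close> by (simp add: s_def)
  define \<delta> where "\<delta> = 4 * T * 2 powr (- (real m / 2))"
  have \<delta>: "0 \<le> \<delta>" using T by (simp add: \<delta>_def)
  have "((2::real) powr (- (real m / 2)))\<^sup>2 = 2 powr (- real m)"
    unfolding power2_eq_square powr_add[symmetric] by simp
  then have sq: "((2::real) powr (- (real m / 2)))\<^sup>2 = 1 / 2 ^ m"
    by (simp add: powr_minus_divide powr_realpow)
  have disc: "(\<Sum>a\<in>X. \<Sum>b\<in>Y. unit_jump (pairing a b)) \<le> \<delta>" if "X \<subseteq> P m" "Y \<subseteq> Q m" for X Y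
  proof (rule power2_le_imp_le[OF _ \<delta>])
    have "(\<Sum>a\<in>X. \<Sum>b\<in>Y. unit_jump (pairing a b))\<^sup>2 \<le> 16 * T\<^sup>2 / 2 ^ m"
      unfolding T_def using that m by (intro pairing_discrepancy) (auto simp: PQ L_def N_def)
    also have "\<dots> = \<delta>\<^sup>2"
      unfolding \<delta>_def power_mult_distrib sq by simp
    finally show "(\<Sum>a\<in>X. \<Sum>b\<in>Y. unit_jump (pairing a b))\<^sup>2 \<le> \<delta>\<^sup>2" .
  qed
  have mass: "(\<Sum>a\<in>P m. \<Sum>b\<in>Q m. of_bool (pairing a b = v)) = T" if "v = 0 \<or> v = 1" for v
    unfolding PQ T_def by (rule card_pairing_eq[OF that])
  have "finite (P m)" "finite (Q m)" by (simp_all add: PQ finite_alice_inputs finite_bob_inputs)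
  then have "T / 3 \<le> 2 powr (4 * real p * s) * \<delta>"
  proof (rule streaming_discrepancy_bound[where v = pairing and correct = correct and F = F
        and M = M and D = D and n = n and k = k and d = d' and alg = alg])
    show "\<not> uses_space_at_least alg p D s" using space by (simp add: s_def)
  qed (fact k D alice bob solves c0 c1 mass[OF disjI1[OF refl]] mass[OF disjI2[OF refl]] disc s \<delta>)+
  also have "\<dots> = 4 * T * (2 powr (4 * real p * s) * 2 powr (- (real m / 2)))"
    by (simp add: \<delta>_def)
  also have "\<dots> = 4 * T * 2 powr (4 * real p * s - real m / 2)"
    unfolding powr_add[symmetric] by simp
  also have "4 * real p * s = real d / 8"
    using \<open>p \<ge> 1\<close> by (simp add: s_def)
  \<comment> \<open>\<open>d / 8 - m / 2 \<le> 1 - d / 8 \<le> - 7\<close>, as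
    \<open>d \<ge> 64\<close>; the contradiction is \<open>T / 3 \<le> T / 32\<close>.\<close>
  also have "4 * T * 2 powr (real d / 8 - real m / 2) \<le> 4 * T * 2 powr (- 7)"
    using T d by (intro mult_left_mono powr_mono) auto
  also have "(2::real) powr (- 7) = 1 / 128" by (simp add: powr_minus_divide)
  finally show False using T by simp
qed

lemma thin_svd_mat:
  assumes "thin_svd (mat n d (\<lambda>(i, l). a i l)) U \<sigma> V"
  shows "svd n d a (\<lambda>j i. U $$ (i, j)) (\<lambda>j l. V $$ (l, j)) \<sigma>"
proof -
  let ?A = "mat n d (\<lambda>(i, l). a i l)"
  interpret s: svd n d "\<lambda>i l. ?A $$ (i, l)" "\<lambda>j i. U $$ (i, j)" "\<lambda>j l. V $$ (l, j)" \<sigma>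
    by (rule thin_svd_svd[OF _ assms]) simp
  have "dot d (a i) y = dot d (\<lambda>l. ?A $$ (i, l)) y" if "i < n" for i y
    using that by (intro dot_cong) auto
  then show ?thesis
    using s.v_orthonormal s.v_complete s.u_orthonormal s.\<sigma>_nonneg s.\<sigma>_antimono s.row_dot_v
    by unfold_locales auto
qed

lemma row_mat_scalar_prod_col:
  assumes "thin_svd (mat n d (\<lambda>(i, l). a i l)) U \<sigma> V" "i < n" "j < d"
  shows "row (mat n d (\<lambda>(i, l). a i l)) i \<bullet> col V j = dot d (a i) (\<lambda>l. V $$ (l, j))"
  unfolding row_scalar_prod_col[OF mat_carrier assms] using assms(2) by (intro dot_cong) auto

lemma leverage_score_eq_ridge: "leverage_score = ridge_leverage_score 0"
  by (simp add: fun_eq_iff leverage_score_def ridge_leverage_score_def)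

lemma bob_input_square_sum_le:
  assumes "b \<in> bob_inputs m L N"
  shows "(\<Sum>l<m. (real_of_int (fst b l))\<^sup>2) \<le> real m * (real N)\<^sup>2"
proof -
  have "(real_of_int (fst b l))\<^sup>2 \<le> (real N)\<^sup>2" if "l < m" for l
    using assms that by (intro power_mono) (force simp: bob_inputs_def PiE_iff)+
  then have "(\<Sum>l<m. (real_of_int (fst b l))\<^sup>2) \<le> (\<Sum>l<m. (real N)\<^sup>2)"
    by (intro sum_mono) auto
  then show ?thesis by simp
qed

lemma ridge_leverage_score_mat:
  assumes "thin_svd (mat n d (\<lambda>(i, l). a i l)) U \<sigma> V" "i < n"
  shows "ridge_leverage_score lam (mat n d (\<lambda>(i, l). a i l)) \<sigma> V i
    = (\<Sum>j | j < d \<and> \<sigma> j > 0. (dot d (a i) (\<lambda>l. V $$ (l, j)))\<^sup>2 / ((\<sigma> j)\<^sup>2 + lam))"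
  unfolding ridge_leverage_score_def dim_col_mat
  by (intro sum.cong refl) (simp only: row_mat_scalar_prod_col[OF assms] mem_Collect_eq)

section \<open>Normal and test vectors, and rows for (ridge) leverage scores\<close>

definition normal_vector :: "nat \<Rightarrow> alice_input \<Rightarrow> nat \<Rightarrow> real" where
  "normal_vector m x l = (if l < m then of_bool (l \<in> fst x) else if l = m then real_of_int (snd x)
    else of_bool (l = m + 1))"

text \<open>Entry \<open>m + 2\<close> lies outside the \<open>m + 2\<close> columns used for
  leverage scores; it takes effect in the rank-\<open>k\<close> problems, where it meets a zero of
  the normal vector.\<close>

definition test_vector :: "nat \<Rightarrow> bob_input \<Rightarrow> nat \<Rightarrow> real" where
  "test_vector m y l = (if l < m then real_of_int (fst y l) else if l = m then 1
    else if l = m + 1 then real_of_int (snd y) else of_bool (l = m + 2))"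

lemma sum_normal_test:
  assumes "x \<in> alice_inputs m L" "m + 2 \<le> d"
  shows "dot d (normal_vector m x) (test_vector m y) = real_of_int (pairing x y)"
proof -
  have S: "fst x \<subseteq> {..<m}" using assms by (auto simp: alice_inputs_def)
  have "dot d (normal_vector m x) (test_vector m y)
      = (\<Sum>l<m + 2. normal_vector m x l * test_vector m y l)"
    unfolding dot_def using assms(2)
    by (intro sum.mono_neutral_right) (auto simp: normal_vector_def)
  also have "\<dots> = (\<Sum>l<m. normal_vector m x l * test_vector m y l) + snd x + snd y"
    by (simp add: normal_vector_def test_vector_def)
  also have "(\<Sum>l<m. normal_vector m x l * test_vector m y l) = (\<Sum>l\<in>fst x. real_of_int (fst y l))"
    using S by (intro sum.mono_neutral_cong_right) (auto simp: normal_vector_def test_vector_def)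
  finally show ?thesis by (simp add: pairing_def)
qed

text \<open>The rows before the last two are \<open>K\<close> times a basis of the hyperplane orthogonal to Alice's normal vector;
  the next one makes the matrix injective, which simplifies the construction of a singular value
  decomposition.\<close>

definition hyperplane_rows :: "nat \<Rightarrow> real \<Rightarrow> real \<Rightarrow> alice_input \<Rightarrow> bob_input \<Rightarrow> nat \<Rightarrow> nat \<Rightarrow> real" where
  "hyperplane_rows m K \<beta> x y i l =
     (if i \<le> m then K * (of_bool (l = i) - normal_vector m x i * of_bool (l = m + 1))
      else if i = m + 1 then of_bool (l = m + 1)
      else if i = m + 2 then \<beta> * test_vector m y l
      else 0)"

lemma dot_indicator: "i < d \<Longrightarrow> dot d (\<lambda>l. of_bool (l = i)) z = z i"
  by (simp add: dot_def of_bool_def if_distrib[of "\<lambda>x. x * _"] cong: if_cong)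

lemma dot_hyperplane_rows:
  assumes "d = m + 2"
  shows "i \<le> m \<Longrightarrow> dot d (hyperplane_rows m K \<beta> x y i) z = K * (z i - normal_vector m x i * z (m + 1))"
    and "dot d (hyperplane_rows m K \<beta> x y (m + 1)) z = z (m + 1)"
    and "dot d (hyperplane_rows m K \<beta> x y (m + 2)) z = \<beta> * dot d z (test_vector m y)"
    and "m + 2 < i \<Longrightarrow> dot d (hyperplane_rows m K \<beta> x y i) z = 0"
proof -
  show "dot d (hyperplane_rows m K \<beta> x y i) z = K * (z i - normal_vector m x i * z (m + 1))" if "i \<le> m"
  proof -
    have "hyperplane_rows m K \<beta> x y i
        = (\<lambda>l. K * of_bool (l = i) - (K * normal_vector m x i) * of_bool (l = m + 1))"
      using that by (auto simp: hyperplane_rows_def fun_eq_iff algebra_simps)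
    then show ?thesis using that assms
      by (simp add: dot_difference_left dot_indicator right_diff_distrib)
  qed
  show "dot d (hyperplane_rows m K \<beta> x y (m + 1)) z = z (m + 1)"
    using dot_indicator[of "m + 1" d z] assms by (simp add: hyperplane_rows_def[abs_def])
  show "dot d (hyperplane_rows m K \<beta> x y (m + 2)) z = \<beta> * dot d z (test_vector m y)"
    by (simp add: hyperplane_rows_def[abs_def] dot_def sum_distrib_left mult_ac)
  show "m + 2 < i \<Longrightarrow> dot d (hyperplane_rows m K \<beta> x y i) z = 0"
    by (simp add: hyperplane_rows_def[abs_def] dot_def)
qed

lemma hyperplane_rows_injective:
  assumes "d = m + 2" "K \<noteq> 0"
    and zero: "\<And>i. i < m + 3 \<Longrightarrow> dot d (hyperplane_rows m K \<beta> x y i) z = 0"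
  shows "dot d z z = 0"
proof -
  have last: "z (m + 1) = 0" using zero[of "m + 1"] dot_hyperplane_rows(2)[OF assms(1)] by simp
  have "z i = 0" if "i \<le> m" for i
    using zero[of i] dot_hyperplane_rows(1)[OF assms(1) that] that last assms(2) by simp
  with last have "z i = 0" if "i < d" for i
    using that assms(1) by (cases "i \<le> m") (auto simp: not_le less_Suc_eq)
  then show ?thesis by (simp add: dot_def)
qed

text \<open>With pairing \<open>0\<close>, Bob's row is a combination of the hyperplane rows. Their
  factor \<open>K\<close> makes the coefficients small, and by \<open>ridge_upper\<close> also the
  score.\<close>

lemma ridge_hyperplane_upper:
  assumes dn: "d = m + 2" "m + 3 \<le> n" and "0 \<le> lam" "K > 0"
    and xy: "x \<in> alice_inputs m L" "y \<in> bob_inputs m L N" "pairing x y = 0"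
    and svd: "thin_svd (mat n d (\<lambda>(i, l). hyperplane_rows m K \<beta> x y i l)) U \<sigma> V"
  shows "ridge_leverage_score lam (mat n d (\<lambda>(i, l). hyperplane_rows m K \<beta> x y i l)) \<sigma> V (m + 2)
    \<le> (\<beta> / K)\<^sup>2 * (real m * (real N)\<^sup>2 + 1)"
proof -
  interpret svd n d "hyperplane_rows m K \<beta> x y" "\<lambda>j i. U $$ (i, j)" "\<lambda>j l. V $$ (l, j)" \<sigma>
    by (rule thin_svd_mat[OF svd])
  \<comment> \<open>Coordinates \<open>l \<le> m\<close> are matched through the unit vectors in the
    rows, which fixes the coefficients; coordinate \<open>m + 1\<close> then fits because the
    pairing vanishes.\<close>
  define c where "c i = of_bool (i \<le> m) * (\<beta> / K * test_vector m y i)" for i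
  have S: "fst x \<subseteq> {..<m}" using xy by (auto simp: alice_inputs_def)
  have comb: "hyperplane_rows m K \<beta> x y (m + 2) l = (\<Sum>i<n. c i * hyperplane_rows m K \<beta> x y i l)"
    if l: "l < d" for l
  proof -
    have "(\<Sum>i<n. c i * hyperplane_rows m K \<beta> x y i l) = (\<Sum>i\<le>m. c i * hyperplane_rows m K \<beta> x y i l)"
      using dn by (intro sum.mono_neutral_right) (auto simp: c_def)
    also have "\<dots> = (\<Sum>i\<le>m. \<beta> * test_vector m y i * (of_bool (l = i) - normal_vector m x i * of_bool (l = m + 1)))"
      using \<open>K > 0\<close> by (intro sum.cong) (auto simp: c_def hyperplane_rows_def)
    also have "\<dots> = \<beta> * test_vector m y l"
    proof (cases "l = m + 1")
      case True
      have "real_of_int (pairing x y) = (\<Sum>i<m + 2. normal_vector m x i * test_vector m y i)"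
        using sum_normal_test[OF xy(1), of "m + 2" y] by (simp add: dot_def)
      also have "\<dots> = (\<Sum>i\<le>m. normal_vector m x i * test_vector m y i) + test_vector m y (m + 1)"
        by (simp add: normal_vector_def flip: lessThan_Suc_atMost)
      finally have "test_vector m y (m + 1) = - (\<Sum>i\<le>m. normal_vector m x i * test_vector m y i)"
        using xy(3) by simp
      moreover have "(\<Sum>i\<le>m. \<beta> * test_vector m y i * (of_bool (m + 1 = i) - normal_vector m x i * of_bool (m + 1 = m + 1)))
          = (\<Sum>i\<le>m. - (\<beta> * (normal_vector m x i * test_vector m y i)))"
        by (intro sum.cong) auto
      ultimately show ?thesis unfolding True by (simp add: sum_distrib_left sum_negf)
    next
      case False
      then have "l \<le> m" using l dn by simp
      have "(\<Sum>i\<le>m. \<beta> * test_vector m y i * (of_bool (l = i) - normal_vector m x i * of_bool (l = m + 1)))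
          = (\<Sum>i\<le>m. if i = l then \<beta> * test_vector m y i else 0)"
        using False by (intro sum.cong) auto
      then show ?thesis using \<open>l \<le> m\<close> by simp
    qed
    finally show ?thesis by (simp add: hyperplane_rows_def)
  qed
  have sq: "(\<Sum>i\<le>m. (test_vector m y i)\<^sup>2) = (\<Sum>i<m. (real_of_int (fst y i))\<^sup>2) + 1"
    by (simp add: test_vector_def flip: lessThan_Suc_atMost)
  have "m + 2 < n" using dn by simp
  then have "ridge_leverage_score lam (mat n d (\<lambda>(i, l). hyperplane_rows m K \<beta> x y i l)) \<sigma> V (m + 2)
      = (\<Sum>j | j < d \<and> \<sigma> j > 0. (dot d (hyperplane_rows m K \<beta> x y (m + 2)) (\<lambda>l. V $$ (l, j)))\<^sup>2 / ((\<sigma> j)\<^sup>2 + lam))"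
    by (rule ridge_leverage_score_mat[OF svd])
  also have "\<dots> \<le> (\<Sum>i<n. (c i)\<^sup>2)"
    using dn \<open>0 \<le> lam\<close> comb by (intro ridge_upper) auto
  also have "\<dots> = (\<Sum>i\<le>m. (c i)\<^sup>2)"
    using dn by (intro sum.mono_neutral_right) (auto simp: c_def)
  also have "\<dots> = (\<beta> / K)\<^sup>2 * (\<Sum>i\<le>m. (test_vector m y i)\<^sup>2)"
    unfolding sum_distrib_left by (intro sum.cong) (auto simp: c_def power_mult_distrib power_divide)
  also have "\<dots> \<le> (\<beta> / K)\<^sup>2 * (real m * (real N)\<^sup>2 + 1)"
    unfolding sq using bob_input_square_sum_le[OF xy(2)] by (intro mult_left_mono) auto
  finally show ?thesis .
qed

text \<open>The test vector for \<open>ridge_lower\<close> is Alice's normal vector: orthogonal to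
  the hyperplane rows, it gets \<open>1\<close> from the extra row and
  \<open>\<beta>\<^sup>2\<close> from Bob's. The bound on \<open>\<beta>\<close> keeps the total,
  with the ridge term, at most \<open>2 * \<beta>\<^sup>2\<close>.\<close>

lemma ridge_hyperplane_lower:
  assumes dn: "d = m + 2" "m + 3 \<le> n" and "0 \<le> lam"
    and xy: "x \<in> alice_inputs m L" "pairing x y = 1"
    and \<beta>: "1 + lam * (real m + (real L)\<^sup>2 + 1) \<le> \<beta>\<^sup>2"
    and svd: "thin_svd (mat n d (\<lambda>(i, l). hyperplane_rows m K \<beta> x y i l)) U \<sigma> V"
  shows "1 / 2 \<le> ridge_leverage_score lam (mat n d (\<lambda>(i, l). hyperplane_rows m K \<beta> x y i l)) \<sigma> V (m + 2)"
    (is "_ \<le> ?R")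
proof -
  interpret svd n d "hyperplane_rows m K \<beta> x y" "\<lambda>j i. U $$ (i, j)" "\<lambda>j l. V $$ (l, j)" \<sigma>
    by (rule thin_svd_mat[OF svd])
  let ?a = "hyperplane_rows m K \<beta> x y"
  define z where "z = normal_vector m x"
  have last: "dot d (?a (m + 2)) z = \<beta>"
    using dot_hyperplane_rows(3)[OF dn(1)] sum_normal_test[OF xy(1)] dn xy(2) by (simp add: z_def)
  have next_last: "dot d (?a (m + 1)) z = 1"
    using dot_hyperplane_rows(2)[OF dn(1)] by (simp add: z_def normal_vector_def)
  have zero: "dot d (?a i) z = 0" if "i \<noteq> m + 1" "i \<noteq> m + 2" for i
  proof (cases "i \<le> m")
    case True
    then show ?thesis
      using dot_hyperplane_rows(1)[OF dn(1) True] by (simp add: z_def normal_vector_def)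
  next
    case False
    then show ?thesis using that dot_hyperplane_rows(4)[OF dn(1)] by simp
  qed
  have "(\<Sum>i<n. (dot d (?a i) z)\<^sup>2) = (\<Sum>i\<in>{m + 1, m + 2}. (dot d (?a i) z)\<^sup>2)"
    using dn zero by (intro sum.mono_neutral_right) auto
  then have e: "(\<Sum>i<n. (dot d (?a i) z)\<^sup>2) = 1 + \<beta>\<^sup>2" using last next_last by simp
  have "dot d z z = (\<Sum>l<m. (of_bool (l \<in> fst x))\<^sup>2) + (real_of_int (snd x))\<^sup>2 + 1"
    by (simp add: dn dot_def z_def normal_vector_def power2_eq_square)
  also have "\<dots> \<le> (\<Sum>l<m. 1) + (real L)\<^sup>2 + 1"
    using xy(1) by (intro add_mono sum_mono power_mono) (auto simp: alice_inputs_def)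
  finally have "lam * dot d z z \<le> lam * (real m + (real L)\<^sup>2 + 1)"
    using \<open>0 \<le> lam\<close> by (intro mult_left_mono) auto
  then have le: "(\<Sum>i<n. (dot d (?a i) z)\<^sup>2) + lam * dot d z z \<le> 2 * \<beta>\<^sup>2"
    using e \<beta> by simp
  have "m + 2 < n" using dn by simp
  note R = ridge_leverage_score_mat[OF svd this, of lam]
  have R0: "0 \<le> ?R" unfolding R using \<open>0 \<le> lam\<close> by (intro sum_nonneg) auto
  have "\<beta>\<^sup>2 \<le> ?R * ((\<Sum>i<n. (dot d (?a i) z)\<^sup>2) + lam * dot d z z)"
    using ridge_lower[of "m + 2" lam z] dn \<open>0 \<le> lam\<close> unfolding R last by simp
  also have "\<dots> \<le> ?R * (2 * \<beta>\<^sup>2)" by (rule mult_left_mono[OF le R0])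
  finally have "\<beta>\<^sup>2 * 1 \<le> \<beta>\<^sup>2 * (2 * ?R)" by (simp add: mult_ac)
  moreover have "0 < \<beta>\<^sup>2"
    using \<beta> \<open>0 \<le> lam\<close> by (intro less_le_trans[OF _ \<beta>] add_pos_nonneg) auto
  ultimately show ?thesis by (simp only: mult_le_cancel_left_pos)
qed

text \<open>\<open>D\<close> may be any class of matrices of this size containing the class of the
  ridge problem, so the bound also serves leverage scores, with \<open>lam = 0\<close> and all
  matrices.\<close>

lemma ridge_space_bound:
  assumes d: "d \<ge> 64" and n: "d + 1 \<le> n" and "p \<ge> 1" and lam: "0 \<le> lam" and c: "1 \<le> c"
    and D: "D \<subseteq> carrier_mat n d"
      "{A \<in> carrier_mat n d. lam \<le> stable_rank A / (2 * real d) * (largest_singular_value A)\<^sup>2} \<subseteq> D"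
    and solves: "solves_whp alg p D (approximates_all c (ridge_leverage_score lam))"
  shows "uses_space_at_least alg p D (1 / 32 * real d / real p)"
proof -
  define m where "m = d - 2"
  have m: "d = m + 2" "m + 3 \<le> n" using d n by (auto simp: m_def)
  define N :: nat where "N = 2 ^ m"
  define L where "L = m * N + 2"
  define \<beta> where "\<beta> = 1 + lam * (real m + (real L)\<^sup>2 + 1)"
  have \<beta>: "1 \<le> \<beta>" using lam by (simp add: \<beta>_def)
  have \<beta>_sq: "1 + lam * (real m + (real L)\<^sup>2 + 1) \<le> \<beta>\<^sup>2"
  proof -
    have "\<beta> \<le> \<beta>\<^sup>2" using \<beta> mult_left_mono[OF \<beta>, of \<beta>] by (simp add: power2_eq_square)
    then show ?thesis unfolding \<beta>_def[symmetric] .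
  qed
  define B where "B = \<beta>\<^sup>2 * (real m * (real N)\<^sup>2 + 1)"
  have B: "0 < B" using \<beta> by (auto simp: B_def intro!: mult_pos_pos add_nonneg_pos)
  \<comment> \<open>The first summand brings the score for pairing \<open>0\<close> down to at most
    \<open>1 / (4 * c\<^sup>2)\<close>; the second makes the Frobenius norm large enough for the
    stable rank condition.\<close>
  define K where "K = sqrt (4 * c\<^sup>2 * B + 2 * real d * lam)"
  have K_sq: "K\<^sup>2 = 4 * c\<^sup>2 * B + 2 * real d * lam"
    using B lam unfolding K_def by (intro real_sqrt_pow2) auto
  have K: "0 < K" using B lam c unfolding K_def
    by (intro real_sqrt_gt_zero add_pos_nonneg mult_pos_pos) auto
  define M where "M x y = mat n d (\<lambda>(i, l). hyperplane_rows m K \<beta> x y i l)" for x y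
  have M_dim: "M x y \<in> carrier_mat n d" for x y by (simp add: M_def)
  have M_D: "M x y \<in> D" for x y
  proof -
    have "stable_rank (M x y) / (2 * real d) * (largest_singular_value (M x y))\<^sup>2
        = (frobenius_norm (M x y))\<^sup>2 / (2 * real d)"
    proof (rule stable_rank_mult[OF M_dim])
      fix z assume z: "\<And>i. i < n \<Longrightarrow> dot d (\<lambda>l. M x y $$ (i, l)) z = 0"
      have "dot d (hyperplane_rows m K \<beta> x y i) z = 0" if "i < n" for i
        using z[OF that] that by (subst dot_cong[where x' = "\<lambda>l. M x y $$ (i, l)" and y' = z]) (auto simp: M_def)
      then show "dot d z z = 0"
        using m K by (intro hyperplane_rows_injective[of d m K \<beta> x y]) auto
    qed (use d in simp)
    moreover have "K\<^sup>2 \<le> (frobenius_norm (M x y))\<^sup>2"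
    proof -
      have "K\<^sup>2 = (hyperplane_rows m K \<beta> x y 0 0)\<^sup>2"
        by (simp add: hyperplane_rows_def)
      also have "\<dots> = (M x y $$ (0, 0))\<^sup>2" using m by (simp add: M_def)
      also have "\<dots> \<le> (\<Sum>j<d. (M x y $$ (0, j))\<^sup>2)"
        using m by (intro member_le_sum) auto
      also have "\<dots> \<le> (\<Sum>i<n. \<Sum>j<d. (M x y $$ (i, j))\<^sup>2)"
        using m by (intro member_le_sum[where f = "\<lambda>i. \<Sum>j<d. (M x y $$ (i, j))\<^sup>2"] sum_nonneg) auto
      also have "\<dots> = (frobenius_norm (M x y))\<^sup>2"
        using M_dim[of x y] by (simp add: frobenius_norm_def sum_nonneg)
      finally show ?thesis .
    qed
    moreover have "2 * real d * lam \<le> K\<^sup>2" using B unfolding K_sq by simp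
    ultimately have "lam \<le> stable_rank (M x y) / (2 * real d) * (largest_singular_value (M x y))\<^sup>2"
      using d by (simp add: pos_le_divide_eq mult_ac)
    then show ?thesis using D(2) M_dim by blast
  qed
  have small: "(\<beta> / K)\<^sup>2 * (real m * (real N)\<^sup>2 + 1) \<le> 1 / (4 * c\<^sup>2)"
  proof -
    have "4 * c\<^sup>2 * B \<le> K\<^sup>2" using lam unfolding K_sq by simp
    then have "B / K\<^sup>2 \<le> 1 / (4 * c\<^sup>2)"
      using K c by (simp add: divide_simps mult_ac)
    then show ?thesis by (simp add: B_def power_divide)
  qed
  show ?thesis
  \<comment> \<open>Alice owns rows \<open>0\<close> to \<open>m + 1\<close>, which are
    \<open>d\<close> rows. Reports for row \<open>m + 2\<close> are at most
    \<open>1 / (4 * c)\<close> for pairing \<open>0\<close> and at least \<open>1 / (2 * c)\<close>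
    for pairing \<open>1\<close>.\<close>
  proof (rule pairing_space_bound[where m = m and k = d and M = M
        and F = "\<lambda>(i, y). i = m + 2 \<and> 1 / (2 * c) \<le> y"])
    show "row (M x y) i = row (M x y') i" if "i < d" for x y y' i
      using that m by (intro eq_vecI) (auto simp: M_def hyperplane_rows_def)
    show "row (M x y) i = row (M x' y) i" if "d \<le> i" "i < n" for x x' y i
      using that m by (intro eq_vecI) (auto simp: M_def hyperplane_rows_def)
    show "\<forall>z\<in>Y. \<not> (case z of (i, r) \<Rightarrow> i = m + 2 \<and> 1 / (2 * c) \<le> r)"
      if xy: "x \<in> alice_inputs m (m * 2 ^ m + 2)" "y \<in> bob_inputs m (m * 2 ^ m + 2) (2 ^ m)"
        "pairing x y = 0" and correct: "approximates_all c (ridge_leverage_score lam) (M x y) Y" for x y Y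
    proof -
      from correct obtain U \<sigma> V where svd: "thin_svd (M x y) U \<sigma> V"
        and Y: "\<And>i r. (i, r) \<in> Y \<Longrightarrow> is_approximation c (ridge_leverage_score lam (M x y) \<sigma> V i) r"
        unfolding approximates_all_def by blast
      have "ridge_leverage_score lam (M x y) \<sigma> V (m + 2) \<le> 1 / (4 * c\<^sup>2)"
        using ridge_hyperplane_upper[OF m lam K _ _ xy(3) svd[unfolded M_def], of L N] xy small
        by (simp add: M_def L_def N_def)
      then have "r \<le> c * (1 / (4 * c\<^sup>2))" if "(m + 2, r) \<in> Y" for r
        using Y[OF that] c unfolding is_approximation_def
        by (meson mult_left_mono order_trans zero_le_one)
      moreover have "c * (1 / (4 * c\<^sup>2)) < 1 / (2 * c)"
        using c by (simp add: power2_eq_square divide_simps)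
      ultimately show ?thesis by force
    qed
    show "\<exists>z\<in>Y. case z of (i, r) \<Rightarrow> i = m + 2 \<and> 1 / (2 * c) \<le> r"
      if xy: "x \<in> alice_inputs m (m * 2 ^ m + 2)" "pairing x y = 1"
        and correct: "approximates_all c (ridge_leverage_score lam) (M x y) Y" for x y Y
    proof -
      from correct obtain U \<sigma> V where svd: "thin_svd (M x y) U \<sigma> V"
        and reported: "\<And>i. i < n \<Longrightarrow> \<exists>r. (i, r) \<in> Y"
        and Y: "\<And>i r. (i, r) \<in> Y \<Longrightarrow> is_approximation c (ridge_leverage_score lam (M x y) \<sigma> V i) r"
        unfolding approximates_all_def carrier_matD(1)[OF M_dim[of x y]] by blast
      obtain r where r: "(m + 2, r) \<in> Y" using reported[of "m + 2"] m by auto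
      have "1 / 2 \<le> ridge_leverage_score lam (M x y) \<sigma> V (m + 2)"
        using ridge_hyperplane_lower[OF m lam _ xy(2) \<beta>_sq svd[unfolded M_def]] xy(1)
        by (simp add: M_def L_def N_def)
      then have "1 / 2 / c \<le> ridge_leverage_score lam (M x y) \<sigma> V (m + 2) / c"
        using c by (intro divide_right_mono) auto
      then have "1 / (2 * c) \<le> r" using Y[OF r] by (simp add: is_approximation_def)
      with r show ?thesis by (intro bexI[of _ "(m + 2, r)"]) auto
    qed
  qed (use d n m M_D D(1) solves \<open>p \<ge> 1\<close> in auto)
qed

section \<open>Rows for rank-k leverage scores and projection distances\<close>

text \<open>Coordinate \<open>m + 2\<close> occurs in Bob's test vector only, so that this vector is never in the span
  of Alice's rows; the coordinates from \<open>m + 3\<close> on serve to bring the rank up to \<open>k\<close>.\<close>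

definition spike_rows :: "nat \<Rightarrow> nat \<Rightarrow> real \<Rightarrow> alice_input \<Rightarrow> bob_input \<Rightarrow> nat \<Rightarrow> nat \<Rightarrow> real" where
  "spike_rows m k K x y i l =
     (if i = 0 then K * normal_vector m x l
      else if i < k then K * of_bool (l = m + 2 + i)
      else if i = k then test_vector m y l
      else 0)"

lemma rank_leverage_score_mat:
  assumes svd: "thin_svd (mat n d (\<lambda>(i, l). a i l)) U \<sigma> V" and i: "i < n" and k: "k \<le> d"
  shows "0 \<le> rank_leverage_score k (mat n d (\<lambda>(i, l). a i l)) \<sigma> V i"
    and "rank_leverage_score k (mat n d (\<lambda>(i, l). a i l)) \<sigma> V i = 0 \<longleftrightarrow>
      (\<forall>j<k. 0 < \<sigma> j \<longrightarrow> dot d (a i) (\<lambda>l. V $$ (l, j)) = 0)"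
proof -
  have eq: "rank_leverage_score k (mat n d (\<lambda>(i, l). a i l)) \<sigma> V i
      = (\<Sum>j | j < d \<and> j < k \<and> \<sigma> j > 0. (dot d (a i) (\<lambda>l. V $$ (l, j)))\<^sup>2 / (\<sigma> j)\<^sup>2)"
    unfolding rank_leverage_score_def dim_col_mat
    by (intro sum.cong refl) (simp only: row_mat_scalar_prod_col[OF svd i] mem_Collect_eq)
  show "0 \<le> rank_leverage_score k (mat n d (\<lambda>(i, l). a i l)) \<sigma> V i"
    unfolding eq by (intro sum_nonneg) auto
  show "rank_leverage_score k (mat n d (\<lambda>(i, l). a i l)) \<sigma> V i = 0 \<longleftrightarrow>
      (\<forall>j<k. 0 < \<sigma> j \<longrightarrow> dot d (a i) (\<lambda>l. V $$ (l, j)) = 0)"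
    unfolding eq using k by (subst sum_nonneg_eq_0_iff) auto
qed

lemma rank_projection_distance_mat:
  assumes svd: "thin_svd (mat n d (\<lambda>(i, l). a i l)) U \<sigma> V" and i: "i < n"
  shows "0 \<le> rank_projection_distance k (mat n d (\<lambda>(i, l). a i l)) \<sigma> V i"
    and "rank_projection_distance k (mat n d (\<lambda>(i, l). a i l)) \<sigma> V i = 0 \<longleftrightarrow>
      (\<forall>j\<in>{k..<d}. dot d (a i) (\<lambda>l. V $$ (l, j)) = 0)"
proof -
  have eq: "rank_projection_distance k (mat n d (\<lambda>(i, l). a i l)) \<sigma> V i
      = (\<Sum>j\<in>{k..<d}. (dot d (a i) (\<lambda>l. V $$ (l, j)))\<^sup>2)"
    unfolding rank_projection_distance_def dim_col_mat
    by (intro sum.cong refl) (simp only: row_mat_scalar_prod_col[OF svd i] atLeastLessThan_iff)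
  show "0 \<le> rank_projection_distance k (mat n d (\<lambda>(i, l). a i l)) \<sigma> V i"
    unfolding eq by (intro sum_nonneg) auto
  show "rank_projection_distance k (mat n d (\<lambda>(i, l). a i l)) \<sigma> V i = 0 \<longleftrightarrow>
      (\<forall>j\<in>{k..<d}. dot d (a i) (\<lambda>l. V $$ (l, j)) = 0)"
    unfolding eq by (subst sum_nonneg_eq_0_iff) auto
qed

text \<open>With the next lemma: an approximation within any finite factor tells zero from nonzero,
  which is why the rank-\<open>k\<close> bounds are independent of the factor.\<close>

lemma is_approximation_zero: "is_approximation c 0 y \<Longrightarrow> y = 0"
  by (simp add: is_approximation_def)

lemma is_approximation_nonzero:
  assumes "is_approximation c x y" "1 \<le> c" "0 \<le> x" "x \<noteq> 0"
  shows "y \<noteq> 0"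
proof -
  have "0 < x / c" using assms by (intro divide_pos_pos) auto
  then show ?thesis using assms(1) by (auto simp: is_approximation_def)
qed

lemma dot_scale_left: "dot d (\<lambda>l. c * x l) y = c * dot d x y"
  by (simp add: dot_def sum_distrib_left mult_ac)

lemma dot_spike_rows:
  assumes "x \<in> alice_inputs m L" "d = m + k + 2" "0 < k"
  shows "dot d (spike_rows m k K x y k) (spike_rows m k K x y 0) = K * real_of_int (pairing x y)"
    and "0 < q \<Longrightarrow> q < k \<Longrightarrow> dot d (spike_rows m k K x y q) z = K * z (m + 2 + q)"
    and "dot d (spike_rows m k K x y 0) z = K * dot d (normal_vector m x) z"
proof -
  show "dot d (spike_rows m k K x y 0) z = K * dot d (normal_vector m x) z" for z
    by (simp add: spike_rows_def[abs_def] dot_scale_left)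
  then have "dot d (spike_rows m k K x y 0) (spike_rows m k K x y k)
      = K * dot d (normal_vector m x) (test_vector m y)"
    using assms by (simp add: spike_rows_def[abs_def])
  then show "dot d (spike_rows m k K x y k) (spike_rows m k K x y 0) = K * real_of_int (pairing x y)"
    using sum_normal_test[OF assms(1), of d y] assms(2) by (simp add: dot_commute)
  show "dot d (spike_rows m k K x y q) z = K * z (m + 2 + q)" if "0 < q" "q < k"
  proof -
    have "spike_rows m k K x y q = (\<lambda>l. K * of_bool (l = m + 2 + q))"
      using that by (auto simp: spike_rows_def)
    then show ?thesis using that assms(2) by (simp add: dot_scale_left dot_indicator)
  qed
qed

text \<open>Each of Alice's rows has an entry \<open>K\<close>, while the left side of the
  hypothesis on \<open>K\<close> bounds the squared norm of Bob's row entry by entry.\<close>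

lemma spike_rows_dominant:
  assumes xy: "x \<in> alice_inputs m L" "y \<in> bob_inputs m L N"
    and d: "d = m + k + 2" "0 < k" "k < n"
    and K: "real m * (real N)\<^sup>2 + (real (m * N + L + 1))\<^sup>2 + 2 < K\<^sup>2"
    and svd: "thin_svd (mat n d (\<lambda>(i, l). spike_rows m k K x y i l)) U \<sigma> V"
  shows "dominant_rows n d (spike_rows m k K x y) (\<lambda>j i. U $$ (i, j)) (\<lambda>j l. V $$ (l, j)) \<sigma> k"
proof -
  interpret svd n d "spike_rows m k K x y" "\<lambda>j i. U $$ (i, j)" "\<lambda>j l. V $$ (l, j)" \<sigma>
    by (rule thin_svd_mat[OF svd])
  let ?a = "spike_rows m k K x y"
  note dots = dot_spike_rows[OF xy(1) d(1,2)]
  have orth: "dot d (?a p) (?a q) = 0" if "p < q" "q < k" for p q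
  proof -
    have "dot d (?a p) (?a q) = dot d (?a q) (?a p)" by (rule dot_commute)
    also have "\<dots> = K * ?a p (m + 2 + q)" using that by (intro dots(2)) auto
    also have "\<dots> = 0" using that by (simp add: spike_rows_def normal_vector_def)
    finally show ?thesis .
  qed
  have upper: "dot d (?a k) (?a k) < K\<^sup>2"
  proof -
    have "dot d (?a k) (?a k) = (\<Sum>l<Suc (Suc (Suc m)). (test_vector m y l)\<^sup>2)"
      unfolding dot_def using d
      by (intro sum.mono_neutral_cong_right) (auto simp: spike_rows_def test_vector_def power2_eq_square)
    also have "\<dots> = (\<Sum>l<m. (real_of_int (fst y l))\<^sup>2) + 1 + (real_of_int (snd y))\<^sup>2 + 1"
      by (simp add: test_vector_def)
    also have "\<dots> \<le> real m * (real N)\<^sup>2 + 1 + (real (m * N + L + 1))\<^sup>2 + 1"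
    proof -
      have "snd y \<in> {- int (m * N + L)..1}"
        using xy(2) unfolding bob_inputs_def by (rule mem_Times_iff[THEN iffD1, THEN conjunct2])
      then have "\<bar>snd y\<bar> \<le> int (m * N + L) + 1"
        unfolding atLeastAtMost_iff using of_nat_0_le_iff[of "m * N + L", where 'a = int] by linarith
      then have "\<bar>snd y\<bar> \<le> int (m * N + L + 1)" by simp
      then have "real_of_int \<bar>snd y\<bar> \<le> real_of_int (int (m * N + L + 1))" by (simp only: of_int_le_iff)
      then have "\<bar>real_of_int (snd y)\<bar> \<le> real (m * N + L + 1)" by (simp only: of_int_abs of_int_of_nat_eq)
      then have "\<bar>real_of_int (snd y)\<bar>\<^sup>2 \<le> (real (m * N + L + 1))\<^sup>2" by (rule power_mono) simp
      then have "(real_of_int (snd y))\<^sup>2 \<le> (real (m * N + L + 1))\<^sup>2" by (simp only: power2_abs)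
      with bob_input_square_sum_le[OF xy(2)] show ?thesis by linarith
    qed
    also have "\<dots> < K\<^sup>2" using K by linarith
    finally show ?thesis .
  qed
  have lower: "K\<^sup>2 \<le> dot d (?a q) (?a q)" if "q < k" for q
  proof -
    obtain l where "l < d" "(?a q l)\<^sup>2 = K\<^sup>2"
    proof (cases "q = 0")
      case True
      then show ?thesis using d by (intro that[of "m + 1"]) (auto simp: spike_rows_def normal_vector_def)
    next
      case False
      then show ?thesis using d \<open>q < k\<close> by (intro that[of "m + 2 + q"]) (auto simp: spike_rows_def)
    qed
    moreover have "(?a q l)\<^sup>2 \<le> (\<Sum>l<d. (?a q l)\<^sup>2)" using \<open>l < d\<close> by (intro member_le_sum) auto
    ultimately show ?thesis by (simp add: dot_def power2_eq_square)
  qed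
  show ?thesis
  proof unfold_locales
    show "dot d (?a p) (?a q) = 0" if "p < k" "q < k" "p \<noteq> q" for p q
    proof (cases "p < q")
      case True
      then show ?thesis using that by (intro orth)
    next
      case False
      then show ?thesis using that by (subst dot_commute) (intro orth, auto)
    qed
    show "dot d (?a k) (?a k) < dot d (?a q) (?a q)" if "q < k" for q
      using upper lower[OF that] by simp
    show "k < n" by (rule d(3))
    show "k \<le> d" unfolding d(1) by linarith
    show "?a i l = 0" if "k < i" for i l using that by (simp add: spike_rows_def)
  qed
qed

lemma spike_rows_cases:
  assumes xy: "x \<in> alice_inputs m L" "y \<in> bob_inputs m L N"
    and d: "d = m + k + 2" "0 < k" "k < n"
    and K: "0 < K" "real m * (real N)\<^sup>2 + (real (m * N + L + 1))\<^sup>2 + 2 < K\<^sup>2"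
    and svd: "thin_svd (mat n d (\<lambda>(i, l). spike_rows m k K x y i l)) U \<sigma> V"
  shows "rank_leverage_score k (mat n d (\<lambda>(i, l). spike_rows m k K x y i l)) \<sigma> V k = 0
      \<longleftrightarrow> pairing x y = 0"
    and "(\<forall>q<k. rank_projection_distance k (mat n d (\<lambda>(i, l). spike_rows m k K x y i l)) \<sigma> V q = 0)
      \<longleftrightarrow> pairing x y = 0"
proof -
  interpret dominant_rows n d "spike_rows m k K x y" "\<lambda>j i. U $$ (i, j)" "\<lambda>j l. V $$ (l, j)" \<sigma> k
    by (rule spike_rows_dominant[OF xy d K(2) svd])
  let ?a = "spike_rows m k K x y"
  note dots = dot_spike_rows[OF xy(1) d(1,2)]
  have orth: "dot d (?a k) (?a q) = 0" if "pairing x y = 0" "q < k" for q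
  proof (cases "q = 0")
    case True
    then show ?thesis using dots(1) that by simp
  next
    case False
    have "dot d (?a k) (?a q) = dot d (?a q) (?a k)" by (rule dot_commute)
    also have "\<dots> = K * ?a k (m + 2 + q)" using False that by (intro dots(2)) auto
    also have "\<dots> = 0" using False that by (simp add: spike_rows_def test_vector_def)
    finally show ?thesis .
  qed
  have oblique: "dot d (?a k) (?a 0) \<noteq> 0" if "pairing x y \<noteq> 0"
    using dots(1) that K(1) by simp
  have kd: "k \<le> d" using d by simp
  show "rank_leverage_score k (mat n d (\<lambda>(i, l). spike_rows m k K x y i l)) \<sigma> V k = 0
      \<longleftrightarrow> pairing x y = 0"
    unfolding rank_leverage_score_mat(2)[OF svd d(3) kd]
    using orthogonal_case(1)[OF orth] oblique_case_leverage[OF d(2) oblique] by blast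
  have "rank_projection_distance k (mat n d (\<lambda>(i, l). spike_rows m k K x y i l)) \<sigma> V q = 0
      \<longleftrightarrow> (\<forall>j\<in>{k..<d}. dot d (?a q) (\<lambda>l. V $$ (l, j)) = 0)" if "q < k" for q
    using rank_projection_distance_mat(2)[OF svd] that d(3) by simp
  note distance = this
  show "(\<forall>q<k. rank_projection_distance k (mat n d (\<lambda>(i, l). spike_rows m k K x y i l)) \<sigma> V q = 0)
      \<longleftrightarrow> pairing x y = 0"
  proof (cases "pairing x y = 0")
    case True
    then show ?thesis
      using distance orthogonal_case(2)[OF orth[OF True]] by simp
  next
    case False
    \<comment> \<open>At coordinate \<open>m + 2\<close> Bob's row is \<open>1\<close> and all of
      Alice's rows vanish.\<close>
    have "\<exists>q<k. \<exists>j\<in>{k..<d}. dot d (?a q) (\<lambda>l. V $$ (l, j)) \<noteq> 0"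
      by (rule oblique_case_distance[OF d(2) oblique[OF False], of "m + 2"])
        (use d in \<open>auto simp: spike_rows_def normal_vector_def test_vector_def\<close>)
    then obtain q j where "q < k" "j \<in> {k..<d}" "dot d (?a q) (\<lambda>l. V $$ (l, j)) \<noteq> 0" by blast
    then show ?thesis using distance[of q] False by blast
  qed
qed

text \<open>\<open>I\<close> lists the rows whose quantities reveal the pairing: Bob's row for
  leverage scores, Alice's rows for distances. The approximation factor may vary with input and
  output.\<close>

lemma rank_space_bound:
  assumes d: "d \<ge> 64" and n: "d + 1 \<le> n" and "p \<ge> 1" and k: "0 < k" "real k \<le> real d / 2"
    and I: "\<And>i. i \<in> I \<Longrightarrow> i \<le> k"
    and nonneg: "\<And>a U \<sigma> V i. thin_svd (mat n d (\<lambda>(i, l). a i l)) U \<sigma> V \<Longrightarrow> i < n \<Longrightarrow>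
      0 \<le> Q (mat n d (\<lambda>(i, l). a i l)) \<sigma> V i"
    and zero_iff: "\<And>m L N K x y U \<sigma> V. x \<in> alice_inputs m L \<Longrightarrow> y \<in> bob_inputs m L N \<Longrightarrow> d = m + k + 2 \<Longrightarrow> 0 < K \<Longrightarrow>
      real m * (real N)\<^sup>2 + (real (m * N + L + 1))\<^sup>2 + 2 < K\<^sup>2 \<Longrightarrow>
      thin_svd (mat n d (\<lambda>(i, l). spike_rows m k K x y i l)) U \<sigma> V \<Longrightarrow>
      (\<forall>i\<in>I. Q (mat n d (\<lambda>(i, l). spike_rows m k K x y i l)) \<sigma> V i = 0) \<longleftrightarrow> pairing x y = 0"
    and solves: "solves_whp alg p (carrier_mat n d) (\<lambda>A Y. \<exists>c\<ge>1. approximates_all c Q A Y)"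
  shows "uses_space_at_least alg p (carrier_mat n d) (1 / 32 * real d / real p)"
proof -
  \<comment> \<open>The columns are \<open>m + 3\<close> coordinates of the test vector and
    \<open>k - 1\<close> fresh ones; \<open>k \<le> d / 2\<close> then gives
    \<open>m \<ge> d / 2 - 2\<close>.\<close>
  define m where "m = d - k - 2"
  have "k + 2 \<le> d" using d k by linarith
  then have m: "d = m + k + 2" by (simp add: m_def)
  have kn: "k < n" using m n by simp
  define N :: nat where "N = 2 ^ m"
  define L where "L = m * N + 2"
  define B where "B = real m * (real N)\<^sup>2 + (real (m * N + L + 1))\<^sup>2 + 2"
  define K where "K = sqrt (B + 1)"
  have "0 \<le> B" by (simp add: B_def)
  then have K: "0 < K" "B < K\<^sup>2" by (simp_all add: K_def)
  define M where "M x y = mat n d (\<lambda>(i, l). spike_rows m k K x y i l)" for x y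
  have M_dim: "M x y \<in> carrier_mat n d" for x y by (simp add: M_def)
  have zero: "(\<forall>i\<in>I. Q (M x y) \<sigma> V i = 0) \<longleftrightarrow> pairing x y = 0"
    if "x \<in> alice_inputs m (m * 2 ^ m + 2)" "y \<in> bob_inputs m (m * 2 ^ m + 2) (2 ^ m)"
      "thin_svd (M x y) U \<sigma> V" for x y U \<sigma> V
    using zero_iff[OF that(1,2) m K(1)] K(2) that(3) by (simp add: M_def B_def L_def N_def)
  show ?thesis
  proof (rule pairing_space_bound[where m = m and k = k and M = M and F = "\<lambda>(i, r). i \<in> I \<and> r \<noteq> 0"])
    show "row (M x y) i = row (M x y') i" if "i < k" for x y y' i
      using that kn by (intro eq_vecI) (auto simp: M_def spike_rows_def)
    show "row (M x y) i = row (M x' y) i" if "k \<le> i" "i < n" for x x' y i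
      using that k by (intro eq_vecI) (auto simp: M_def spike_rows_def)
    show "\<forall>z\<in>Y. \<not> (case z of (i, r) \<Rightarrow> i \<in> I \<and> r \<noteq> 0)"
      if xy: "x \<in> alice_inputs m (m * 2 ^ m + 2)" "y \<in> bob_inputs m (m * 2 ^ m + 2) (2 ^ m)"
        "pairing x y = 0" and correct: "\<exists>c\<ge>1. approximates_all c Q (M x y) Y" for x y Y
    proof -
      from correct obtain c U \<sigma> V where svd: "thin_svd (M x y) U \<sigma> V"
        and Y: "\<And>i r. (i, r) \<in> Y \<Longrightarrow> is_approximation c (Q (M x y) \<sigma> V i) r"
        unfolding approximates_all_def by blast
      have "r = 0" if "(i, r) \<in> Y" "i \<in> I" for i r
        using Y[OF that(1)] zero[OF xy(1,2) svd] xy(3) that(2) is_approximation_zero by auto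
      then show ?thesis by auto
    qed
    show "\<exists>z\<in>Y. case z of (i, r) \<Rightarrow> i \<in> I \<and> r \<noteq> 0"
      if xy: "x \<in> alice_inputs m (m * 2 ^ m + 2)" "y \<in> bob_inputs m (m * 2 ^ m + 2) (2 ^ m)"
        "pairing x y = 1" and correct: "\<exists>c\<ge>1. approximates_all c Q (M x y) Y" for x y Y
    proof -
      from correct obtain c U \<sigma> V where svd: "thin_svd (M x y) U \<sigma> V" and c: "1 \<le> c"
        and reported: "\<And>i. i < n \<Longrightarrow> \<exists>r. (i, r) \<in> Y"
        and Y: "\<And>i r. (i, r) \<in> Y \<Longrightarrow> is_approximation c (Q (M x y) \<sigma> V i) r"
        unfolding approximates_all_def carrier_matD(1)[OF M_dim[of x y]] by blast
      obtain i where i: "i \<in> I" "Q (M x y) \<sigma> V i \<noteq> 0"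
        using zero[OF xy(1,2) svd] xy(3) by auto
      have "i < n" using I[OF i(1)] kn by simp
      then obtain r where r: "(i, r) \<in> Y" using reported by blast
      have "r \<noteq> 0"
        using is_approximation_nonzero[OF Y[OF r] c _ i(2)] nonneg[OF svd[unfolded M_def] \<open>i < n\<close>]
        by (simp add: M_def)
      with r i show ?thesis by (intro bexI[of _ "(i, r)"]) auto
    qed
    show "real d / 2 - 2 \<le> real m" using k(2) m by simp
  qed (use d kn k M_dim solves \<open>p \<ge> 1\<close> in auto)
qed

text \<open>The reductions give bounds independent of \<open>t\<close>; those with \<open>t\<close>
  are weaker because \<open>t\<^sup>2 * ln t \<ge> 2\<close> for \<open>t \<ge> 2\<close>.\<close>

lemma space_bound_le:
  fixes t :: nat and p d :: real
  assumes "2 \<le> t" "1 \<le> p" "0 \<le> d"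
  shows "1 / 32 * d / ((real t)\<^sup>2 * p * ln (real t)) \<le> 1 / 32 * d / p"
proof -
  have "1 / 2 \<le> ln (2::real)" using ln2_ge_two_thirds by simp
  also have "ln (2::real) \<le> ln (real t)" using assms by (subst ln_le_cancel_iff) auto
  finally have l: "1 / 2 \<le> ln (real t)" .
  have "2\<^sup>2 \<le> (real t)\<^sup>2" using assms by (intro power_mono) auto
  then have "4 * (1 / 2) \<le> (real t)\<^sup>2 * ln (real t)" using l by (intro mult_mono) auto
  then have "1 * p \<le> ((real t)\<^sup>2 * ln (real t)) * p" using assms by (intro mult_right_mono) auto
  also have "\<dots> = (real t)\<^sup>2 * p * ln (real t)" by (simp only: mult_ac)
  finally show ?thesis using assms by (intro frac_le) auto
qed

theorem theorem12:
  shows "\<exists>(c::real) (C::real) (d0::nat). c > 0 \<and> C \<ge> 1 \<and>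
    (\<forall>(d::nat) (n::nat) (p::nat). d \<ge> d0 \<and> real n \<ge> C * real d \<and> p \<ge> 1 \<longrightarrow>
      (\<forall>t::nat. t \<ge> 2 \<longrightarrow>
        (\<forall>alg.
          solves_whp alg p (carrier_mat n d)
            (approximates_all (sqrt (real t)) leverage_score) \<longrightarrow>
          uses_space_at_least alg p (carrier_mat n d)
            (c * real d / ((real t)\<^sup>2 * real p * ln (real t))))) \<and>
      (\<forall>(t::nat) (lam::real). t \<ge> 2 \<and> lam \<ge> 0 \<longrightarrow>
        (let D = {A \<in> carrier_mat n d.
                    lam \<le> stable_rank A / (2 * real d) * (largest_singular_value A)\<^sup>2}
         in \<forall>alg.
          solves_whp alg p D
            (approximates_all (sqrt (real t / 2)) (ridge_leverage_score lam)) \<longrightarrow>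
          uses_space_at_least alg p D
            (c * real d / (real p * (real t)\<^sup>2 * ln (real t))))) \<and>
      (\<forall>k::nat. 2 \<le> k \<and> real k \<le> real d / 2 \<longrightarrow>
        (\<forall>alg.
          solves_whp alg p (carrier_mat n d)
            (\<lambda>A Y. \<exists>c'\<ge>1. approximates_all c' (rank_leverage_score k) A Y) \<longrightarrow>
          uses_space_at_least alg p (carrier_mat n d) (c * real d / real p))) \<and>
      (\<forall>k::nat. 2 \<le> k \<and> real k \<le> real d / 2 \<longrightarrow>
        (\<forall>alg.
          solves_whp alg p (carrier_mat n d)
            (\<lambda>A Y. \<exists>c'\<ge>1. approximates_all c' (rank_projection_distance k) A Y) \<longrightarrow>
          uses_space_at_least alg p (carrier_mat n d) (c * real d / real p))))"
\<comment> \<open>\<open>d \<ge> 64\<close> serves the numerical estimate, and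
  \<open>n \<ge> 2 * d\<close> leaves room for \<open>d\<close> rows of Alice and one of
  Bob.\<close>
proof (rule exI[of _ "1 / 32"], rule exI[of _ 2], rule exI[of _ 64], intro conjI allI impI)
  fix d n p :: nat
  assume "64 \<le> d \<and> 2 * real d \<le> real n \<and> 1 \<le> p"
  then have d: "64 \<le> d" and n: "d + 1 \<le> n" and p: "1 \<le> p" by auto
  note weaken = uses_space_at_least_mono[OF _ space_bound_le]
  show "uses_space_at_least alg p (carrier_mat n d) (1 / 32 * real d / ((real t)\<^sup>2 * real p * ln (real t)))"
    if t: "2 \<le> t" and "solves_whp alg p (carrier_mat n d) (approximates_all (sqrt (real t)) leverage_score)"
    for t alg
    using that p unfolding leverage_score_eq_ridge
    by (intro weaken ridge_space_bound[OF d n p, of 0 "sqrt (real t)"]) auto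
  show "let D = {A \<in> carrier_mat n d.
                    lam \<le> stable_rank A / (2 * real d) * (largest_singular_value A)\<^sup>2}
         in \<forall>alg. solves_whp alg p D (approximates_all (sqrt (real t / 2)) (ridge_leverage_score lam)) \<longrightarrow>
          uses_space_at_least alg p D (1 / 32 * real d / (real p * (real t)\<^sup>2 * ln (real t)))"
    if "2 \<le> t \<and> 0 \<le> lam" for t lam
    \<comment> \<open>Here \<open>t \<ge> 2\<close> ensures that the factor
      \<open>sqrt (t / 2)\<close> is at least \<open>1\<close>.\<close>
    unfolding Let_def mult.commute[of "real p" "(real t)\<^sup>2"] using that p
    by (intro allI impI weaken ridge_space_bound[OF d n p, of lam "sqrt (real t / 2)"]) auto
  fix k :: nat
  assume "2 \<le> k \<and> real k \<le> real d / 2"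
  then have k: "0 < k" "real k \<le> real d / 2" by auto
  have kn: "k < n" "k \<le> d" using k(2) n d by linarith+
  show "uses_space_at_least alg p (carrier_mat n d) (1 / 32 * real d / real p)"
    if "solves_whp alg p (carrier_mat n d) (\<lambda>A Y. \<exists>c'\<ge>1. approximates_all c' (rank_leverage_score k) A Y)" for alg
    by (rule rank_space_bound[where Q = "rank_leverage_score k" and I = "{k}", OF d n p k _ _ _ that])
      (simp_all add: rank_leverage_score_mat(1)[OF _ _ kn(2)] spike_rows_cases(1)[OF _ _ _ k(1) kn(1)])
  show "uses_space_at_least alg p (carrier_mat n d) (1 / 32 * real d / real p)"
    if "solves_whp alg p (carrier_mat n d) (\<lambda>A Y. \<exists>c'\<ge>1. approximates_all c' (rank_projection_distance k) A Y)" for alg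
    by (rule rank_space_bound[where Q = "rank_projection_distance k" and I = "{..<k}", OF d n p k _ _ _ that])
      (simp_all add: rank_projection_distance_mat(1) spike_rows_cases(2)[OF _ _ _ k(1) kn(1)] Ball_def)
qed simp_all

end
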